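(* Let $k\ge 2$ be an integer and set $\kappa=2^{k-1}$. For every $\epsilon>0$ there is a constant $C(k,\epsilon)>0$, depending only on $k$ and $\epsilon$, such that for every sequence of complex numbers $\{a_n\}$ and all positive integers $Q,M,N$, $$\sum_{q=1}^Q \sum_{\substack{a \bmod q^k \\ \gcd(a,q)=1}} \left| \sum_{n=M+1}^{M+N} a_n\, e\!\left( \frac{a}{q^k} n \right) \right|^2 \le C(k,\epsilon)\, \log (2Q) \left[ Q^{k+1} + N^{\epsilon} \left( NQ^{\frac{\kappa-1}{\kappa}} + N^{1-\frac{1}{\kappa}} Q^{\frac{\kappa+k}{\kappa}} \right) \right] \sum_{n=M+1}^{M+N} |a_n|^2 .$$
   Context: $e(z)=\exp(2\pi i z)$. The sum over $a \bmod q^k$ with $\gcd(a,q)=1$ runs over a set of representatives of the residue classes modulo $q^k$ that are coprime to $q$. *)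

theory Defs
  imports "HOL-Analysis.Analysis"
begin

definition unit_exp :: "complex \<Rightarrow> complex" where
  "unit_exp z = exp (2 * of_real pi * \<i> * z)"

text \<open>The least positive representatives of the residue classes modulo \<open>q ^ k\<close> that are
  coprime to \<open>q\<close>. As \<open>unit_exp\<close> has period 1, the sums below do not depend on the choice of
  representatives. For \<open>q = 1\<close> the set is \<open>{1}\<close>, the single class modulo 1.\<close>

definition coprime_residues :: "nat \<Rightarrow> nat \<Rightarrow> nat set" where
  "coprime_residues k q = {a \<in> {1..q ^ k}. gcd a q = 1}"

end

theory Submission
  imports Defs "HOL-Library.Real_Mod"
begin

text \<open>If \<open>N \<le> Q ^ k\<close>, orthogonality of the additive characters modulo each \<open>q ^ k\<close> already gives
  \<open>Q ^ (k + 1)\<close>. Otherwise, by duality, a Schur test and the bound for geometric sums, it is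
  enough to bound the number \<open>K\<close> of fractions \<open>b / q ^ k\<close> in an arc of length \<open>1 / N\<close>; the
  logarithm lost here is absorbed by \<open>N powr \<epsilon>\<close>. Different fractions in the arc have different
  \<open>q\<close>. If \<open>b' / p ^ k\<close> is the one with the largest denominator, then \<open>b' q ^ k\<close> is within
  \<open>R = p ^ (2 k) / N\<close> of a multiple of \<open>p ^ k\<close> for each such \<open>q\<close>. Taking \<open>k - 1\<close> differences
  combinatorially, without exponential sums, bounds \<open>K ^ \<kappa>\<close> by
  \<open>p ^ (\<kappa> - k)\<close> times the number of \<open>(h\<^sub>1, \<dots>, h\<^sub>k\<^sub>-\<^sub>1, y)\<close> such that
  \<open>const * b' h\<^sub>1 \<dots> h\<^sub>k\<^sub>-\<^sub>1 y\<close> is close to a multiple of \<open>p ^ k\<close>. By the divisor bound there are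
  \<open>O(p ^ (k - 1) + p powr \<delta> * (1 + R))\<close> of them.\<close>

section \<open>The divisor bound\<close>

lemma card_divisors_mult_le:
  fixes a b :: nat
  assumes "a > 0" "b > 0"
  shows "card {d. d dvd a * b} \<le> card {d. d dvd a} * card {d. d dvd b}"
proof -
  have "{d. d dvd a * b} \<subseteq> (\<lambda>(x, y). x * y) ` ({d. d dvd a} \<times> {d. d dvd b})"
  proof
    fix d assume "d \<in> {d. d dvd a * b}"
    then obtain x y where "d = x * y" "x dvd a" "y dvd b"
      by (auto elim: dvd_productE)
    then show "d \<in> (\<lambda>(x, y). x * y) ` ({d. d dvd a} \<times> {d. d dvd b})"
      by force
  qed
  moreover have "finite ({d. d dvd a} \<times> {d. d dvd b})"
    using assms by simp
  ultimately have "card {d. d dvd a * b} \<le> card ({d. d dvd a} \<times> {d. d dvd b})"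
    using surj_card_le by blast
  then show ?thesis
    by (simp add: card_cartesian_product)
qed

lemma card_divisors_prime_power:
  fixes p :: nat
  assumes "prime p"
  shows "card {d. d dvd p ^ e} \<le> e + 1"
proof -
  have "{d. d dvd p ^ e} = (\<lambda>i. p ^ i) ` {..e}"
    using divides_primepow_nat[OF assms] by auto
  then show ?thesis
    using card_image_le[of "{..e}" "\<lambda>i. p ^ i"] by simp
qed

text \<open>Only the primes below \<open>2 powr (1 / \<delta>)\<close> can push \<open>d(n) / n powr \<delta>\<close> above 1, each by a
  bounded factor.\<close>

lemma divisor_bound:
  fixes \<delta> :: real
  assumes "\<delta> > 0"
  obtains C where "C \<ge> 1" "\<And>n::nat. n > 0 \<Longrightarrow> real (card {d. d dvd n}) \<le> C * real n powr \<delta>"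
proof -
  define P where "P = 2 powr (1 / \<delta>)"
  \<comment> \<open>This choice gives \<open>B \<ge> 1\<close> and
    \<open>B * \<delta> * ln 2 \<ge> 1\<close>, hence
    \<open>e + 1 \<le> B * (1 + e * \<delta> * ln 2)\<close> for every exponent
    \<open>e\<close>.\<close>
  define B where "B = 1 + 1 / (\<delta> * ln 2)"
  define S where "S n = {p::nat. prime p \<and> real p \<le> P \<and> p dvd n}" for n :: nat
  have finP: "finite {p::nat. real p \<le> P}"
    by (rule finite_subset[of _ "{..nat \<lfloor>P\<rfloor>}"]) (auto simp: le_nat_floor)
  have finS: "finite (S n)" for n
    by (rule finite_subset[OF _ finP]) (auto simp: S_def)
  have B1: "B \<ge> 1"
    using assms by (simp add: B_def)
  \<comment> \<open>For \<open>p\<close> above \<open>P\<close> the number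
    \<open>p powr \<delta>\<close> is at least 2, which beats \<open>e + 1 \<le> 2 ^ e\<close>. For
    smaller \<open>p\<close> the inequality \<open>1 + x \<le> exp x\<close> suffices, at the cost
    of a factor \<open>B\<close>.\<close>
  have step: "real (e + 1) \<le> (if real p \<le> P then B else 1) * real (p ^ e) powr \<delta>"
    if p: "prime p" for p e :: nat
  proof (cases "real p \<le> P")
    case True
    have "1 + real e * (\<delta> * ln 2) \<le> exp (real e * (\<delta> * ln 2))"
      by (rule exp_ge_add_one_self)
    also have "\<dots> = real (2 ^ e) powr \<delta>"
      by (simp add: powr_def ln_realpow mult_ac)
    also have "\<dots> \<le> real (p ^ e) powr \<delta>"
      using prime_ge_2_nat[OF p] assms by (intro powr_mono2) (auto intro: power_mono)
    finally have *: "1 + real e * (\<delta> * ln 2) \<le> real (p ^ e) powr \<delta>" .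
    have "real (e + 1) \<le> B * (1 + real e * (\<delta> * ln 2))"
      using assms by (simp add: B_def field_simps)
    also have "\<dots> \<le> B * real (p ^ e) powr \<delta>"
      using * B1 by (intro mult_left_mono) auto
    finally show ?thesis
      using True by simp
  next
    case False
    have "2 = P powr \<delta>"
      using assms by (simp add: P_def powr_powr)
    also have "\<dots> \<le> real p powr \<delta>"
      using False assms by (intro powr_mono2) (auto simp: P_def)
    finally have 2: "2 \<le> real p powr \<delta>" .
    have "real (e + 1) \<le> 2 ^ e"
      by (induction e) auto
    also have "\<dots> \<le> (real p powr \<delta>) ^ e"
      using 2 by (intro power_mono) auto
    also have "\<dots> = real (p ^ e) powr \<delta>"
      using prime_gt_0_nat[OF p] by (simp add: powr_power powr_realpow[symmetric] powr_powr mult_ac)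
    finally show ?thesis
      using False by simp
  qed
  have main: "real (card {d. d dvd n}) \<le> B ^ card (S n) * real n powr \<delta>" if "n > 0" for n :: nat
    using that
  proof (induction n rule: less_induct)
    case (less n)
    show ?case
    proof (cases "n = 1")
      case True
      then show ?thesis
        using B1 by simp
    next
      case False
      then obtain p where p: "prime p" "p dvd n"
        using prime_factor_nat by blast
      \<comment> \<open>Removing the whole power of \<open>p\<close> keeps \<open>p\<close> out of
        \<open>S m\<close>, so each small prime is charged its factor \<open>B\<close> only
        once.\<close>
      have "n \<noteq> 0" "\<not> is_unit p"
        using less.prems p by auto
      then obtain m where m: "n = p ^ multiplicity p n * m" "\<not> p dvd m"
        using multiplicity_decompose' by blast
      define e where "e = multiplicity p n"
      have ne: "n = p ^ e * m"
        using m(1) by (simp add: e_def)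
      have e0: "e > 0"
        using p m(2) ne by (cases e) auto
      have m0: "m > 0"
        using ne less.prems by (cases m) auto
      have "p ^ e > 1"
        by (rule one_less_power[OF prime_gt_1_nat[OF p(1)] e0])
      then have mn: "m < n"
        using m0 ne by simp
      have "real (card {d. d dvd n}) \<le> real (card {d. d dvd p ^ e}) * real (card {d. d dvd m})"
        unfolding ne of_nat_mult[symmetric] of_nat_le_iff
        by (rule card_divisors_mult_le) (use m0 prime_gt_0_nat[OF p(1)] in auto)
      also have "\<dots> \<le> real (e + 1) * real (card {d. d dvd m})"
        using card_divisors_prime_power[OF p(1), of e]
        by (intro mult_right_mono) (auto simp del: of_nat_add)
      also have "\<dots> \<le> ((if real p \<le> P then B else 1) * real (p ^ e) powr \<delta>) *
                        (B ^ card (S m) * real m powr \<delta>)"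
        using B1 by (intro mult_mono step p less.IH mn m0) auto
      also have "\<dots> = ((if real p \<le> P then B else 1) * B ^ card (S m)) * real n powr \<delta>"
        by (simp add: ne powr_mult)
      also have "(if real p \<le> P then B else 1) * B ^ card (S m) \<le> B ^ card (S n)"
      proof (cases "real p \<le> P")
        case True
        have "insert p (S m) \<subseteq> S n" "p \<notin> S m"
          using True p m(2) ne by (auto simp: S_def)
        then have "Suc (card (S m)) \<le> card (S n)"
          using card_mono[OF finS, of "insert p (S m)" n] finS by simp
        then have "B ^ Suc (card (S m)) \<le> B ^ card (S n)"
          using B1 by (intro power_increasing) auto
        then show ?thesis
          using True by simp
      next
        case False
        have "S m \<subseteq> S n"
          using ne by (auto simp: S_def)
        then have "card (S m) \<le> card (S n)"
          by (intro card_mono finS)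
        then show ?thesis
          using False B1 by (simp add: power_increasing)
      qed
      finally show ?thesis
        by (simp add: mult_right_mono)
    qed
  qed
  have "real (card {d. d dvd n}) \<le> B ^ card {p::nat. real p \<le> P} * real n powr \<delta>" if "n > 0" for n
  proof -
    have "B ^ card (S n) \<le> B ^ card {p::nat. real p \<le> P}"
      using B1 by (intro power_increasing card_mono finP) (auto simp: S_def)
    then show ?thesis
      using main[OF that] by (meson mult_right_mono order_trans powr_ge_zero)
  qed
  moreover have "B ^ card {p::nat. real p \<le> P} \<ge> 1"
    using B1 by simp
  ultimately show ?thesis
    using that by blast
qed

section \<open>Combinatorial Weyl differencing\<close>

text \<open>In terms of fractions, \<open>v / m\<close> lies within \<open>R / m\<close> of an
  integer. The unscaled form keeps everything in the integers, and a difference merely doubles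
  \<open>R\<close>.\<close>

definition near_multiple :: "int \<Rightarrow> real \<Rightarrow> int \<Rightarrow> bool" where
  "near_multiple m R v \<longleftrightarrow> (\<exists>t. \<bar>real_of_int (v - t * m)\<bar> \<le> R)"

lemma near_multiple_diff:
  assumes "near_multiple m R u" "near_multiple m R v"
  shows "near_multiple m (2 * R) (u - v)"
proof -
  obtain s t where "\<bar>real_of_int (u - s * m)\<bar> \<le> R" "\<bar>real_of_int (v - t * m)\<bar> \<le> R"
    using assms unfolding near_multiple_def by blast
  then have "\<bar>real_of_int (u - v - (s - t) * m)\<bar> \<le> 2 * R"
    by (simp add: algebra_simps)
  then show ?thesis
    unfolding near_multiple_def by blast
qed

text \<open>Iterated Cauchy-Schwarz: one application replaces \<open>f\<close> by its square and
  halves the outer exponent. The factor \<open>card I\<close> on the left avoids a division or an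
  exponent \<open>2 ^ j - 1\<close>.\<close>

lemma power_mean_two_power:
  fixes f :: "'a \<Rightarrow> real"
  assumes "\<And>i. i \<in> I \<Longrightarrow> f i \<ge> 0"
  shows "(\<Sum>i\<in>I. f i) ^ 2 ^ j * real (card I) \<le> real (card I) ^ 2 ^ j * (\<Sum>i\<in>I. f i ^ 2 ^ j)"
  using assms
proof (induction j arbitrary: f)
  case 0
  then show ?case by simp
next
  case (Suc j)
  have "(\<Sum>i\<in>I. f i) ^ 2 ^ Suc j * real (card I) = ((\<Sum>i\<in>I. f i)\<^sup>2) ^ 2 ^ j * real (card I)"
    by (simp add: power_mult)
  also have "\<dots> \<le> ((\<Sum>i\<in>I. (f i)\<^sup>2) * real (card I)) ^ 2 ^ j * real (card I)"
    by (intro mult_right_mono power_mono sum_squared_le_sum_of_squares) auto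
  also have "\<dots> = real (card I) ^ 2 ^ j * ((\<Sum>i\<in>I. (f i)\<^sup>2) ^ 2 ^ j * real (card I))"
    by (simp add: power_mult_distrib)
  also have "\<dots> \<le> real (card I) ^ 2 ^ j * (real (card I) ^ 2 ^ j * (\<Sum>i\<in>I. ((f i)\<^sup>2) ^ 2 ^ j))"
    by (intro mult_left_mono Suc.IH) auto
  also have "\<dots> = real (card I) ^ 2 ^ Suc j * (\<Sum>i\<in>I. f i ^ 2 ^ Suc j)"
    by (simp add: power_mult[symmetric] mult.assoc[symmetric] power_add[symmetric])
       (simp add: mult_2)
  finally show ?case .
qed

text \<open>Differencing centrally, \<open>g (y + h) - g (y - h)\<close>, keeps the second highest coefficient equal to
  zero, so that after \<open>j\<close> steps exactly a monomial in \<open>h\<^sub>1, \<dots>, h\<^sub>j, y\<close> is left. The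
  divisibility of the points by \<open>2 ^ j\<close> makes all midpoints integral.\<close>

lemma central_difference_coeffs:
  fixes c :: "nat \<Rightarrow> int" and r :: nat and y h :: int
  defines "c' \<equiv> \<lambda>h i. \<Sum>n\<le>Suc r. c n * (of_nat (n choose i) * (h ^ (n - i) - (- h) ^ (n - i)))"
  assumes "c r = 0"
  shows "(\<Sum>n\<le>Suc r. c n * (y + h) ^ n) - (\<Sum>n\<le>Suc r. c n * (y - h) ^ n) = (\<Sum>i\<le>r. c' h i * y ^ i)"
    and "r > 0 \<Longrightarrow> c' h (r - 1) = 0"
    and "c' h r = 2 * of_nat (Suc r) * h * c (Suc r)"
proof -
  have bin: "(y + u) ^ n = (\<Sum>i\<le>Suc r. of_nat (n choose i) * u ^ (n - i) * y ^ i)"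
    if "n \<le> Suc r" for n and u :: int
  proof -
    have "(y + u) ^ n = (\<Sum>i\<le>n. of_nat (n choose i) * u ^ (n - i) * y ^ i)"
      by (subst binomial_ring) (simp add: mult_ac)
    also have "\<dots> = (\<Sum>i\<le>Suc r. of_nat (n choose i) * u ^ (n - i) * y ^ i)"
      using that by (intro sum.mono_neutral_left) (auto simp: binomial_eq_0)
    finally show ?thesis .
  qed
  have "(\<Sum>n\<le>Suc r. c n * (y + h) ^ n) - (\<Sum>n\<le>Suc r. c n * (y - h) ^ n) =
        (\<Sum>n\<le>Suc r. c n * ((y + h) ^ n - (y + (- h)) ^ n))"
    by (simp add: sum_subtractf[symmetric] algebra_simps del: sum.atMost_Suc)
  also have "\<dots> = (\<Sum>n\<le>Suc r. \<Sum>i\<le>Suc r.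
        c n * (of_nat (n choose i) * (h ^ (n - i) - (- h) ^ (n - i))) * y ^ i)"
  proof (intro sum.cong refl)
    fix n assume "n \<in> {..Suc r}"
    then show "c n * ((y + h) ^ n - (y + (- h)) ^ n) = (\<Sum>i\<le>Suc r.
        c n * (of_nat (n choose i) * (h ^ (n - i) - (- h) ^ (n - i))) * y ^ i)"
      unfolding atMost_iff
      by (subst (1 2) bin, simp, simp)
         (simp add: sum_subtractf[symmetric] sum_distrib_left algebra_simps del: sum.atMost_Suc)
  qed
  also have "\<dots> = (\<Sum>i\<le>Suc r. c' h i * y ^ i)"
    unfolding c'_def by (subst sum.swap) (simp add: sum_distrib_right del: sum.atMost_Suc)
  also have "c' h (Suc r) = 0"
    unfolding c'_def by (rule sum.neutral) (auto simp: binomial_eq_0 le_Suc_eq)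
  then have "(\<Sum>i\<le>Suc r. c' h i * y ^ i) = (\<Sum>i\<le>r. c' h i * y ^ i)"
    by simp
  finally show "(\<Sum>n\<le>Suc r. c n * (y + h) ^ n) - (\<Sum>n\<le>Suc r. c n * (y - h) ^ n) =
      (\<Sum>i\<le>r. c' h i * y ^ i)" .
  have "c' h r = (\<Sum>n\<in>{Suc r}. c n * (of_nat (n choose r) * (h ^ (n - r) - (- h) ^ (n - r))))"
    unfolding c'_def
  proof (rule sum.mono_neutral_right)
    show "\<forall>n\<in>{..Suc r} - {Suc r}. c n * (of_nat (n choose r) * (h ^ (n - r) - (- h) ^ (n - r))) = 0"
      using assms(2) by (auto simp: binomial_eq_0 le_Suc_eq)
  qed auto
  then show "c' h r = 2 * of_nat (Suc r) * h * c (Suc r)"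
    by (simp add: algebra_simps)
  \<comment> \<open>This is where the central form matters: the term \<open>n = r + 1\<close>
    carries \<open>h\<^sup>2 - (- h)\<^sup>2 = 0\<close>, the term \<open>n = r\<close> has
    coefficient zero, and \<open>n = r - 1\<close> carries a difference of zeroth powers.\<close>
  show "c' h (r - 1) = 0" if "r > 0"
    unfolding c'_def
  proof (rule sum.neutral, rule ballI)
    fix n assume n: "n \<in> {..Suc r}"
    consider "n < r - 1" | "n = r - 1" | "n = r" | "n = Suc r"
      using n by force
    then show "c n * (of_nat (n choose (r - 1)) * (h ^ (n - (r - 1)) - (- h) ^ (n - (r - 1)))) = 0"
    proof cases
      case 4
      then have "n - (r - 1) = 2"
        using that by simp
      then show ?thesis by simp
    qed (use assms(2) in \<open>auto simp: binomial_eq_0\<close>)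
  qed
qed

text \<open>The last condition concerns the \<open>j\<close>-fold central difference, with half steps \<open>hs\<close> and
  centre \<open>y\<close>, of a polynomial \<open>c x\<^sup>j\<^sup>+\<^sup>1 + 0 x\<^sup>j + \<dots>\<close>.\<close>

definition cubes :: "nat \<Rightarrow> nat \<Rightarrow> int \<Rightarrow> real \<Rightarrow> int \<Rightarrow> (int list \<times> int) set" where
  "cubes j L m R c = {(hs, y). length hs = j \<and> set hs \<subseteq> {- int L..int L} \<and> y \<in> {1..int L} \<and>
     near_multiple m (2 ^ j * R) (2 ^ j * fact (j + 1) * c * prod_list hs * y)}"

lemma finite_cubes: "finite (cubes j L m R c)"
proof (rule finite_subset)
  show "cubes j L m R c \<subseteq> {hs. set hs \<subseteq> {- int L..int L} \<and> length hs = j} \<times> {1..int L}"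
    by (auto simp: cubes_def)
qed (auto intro: finite_lists_length_eq)

text \<open>With \<open>W = 2 * L + 1\<close> this compares densities:
  \<open>(card A / W) ^ 2 ^ j\<close> is at most \<open>card (cubes ...) / W ^ (j + 1)\<close>. Each
  step trades pairs of points of \<open>A\<close> for a half difference \<open>h\<close> and a
  midpoint. For fixed \<open>h\<close> the midpoints satisfy the same hypotheses for the differenced
  polynomial, with degree lowered by one and \<open>R\<close> doubled.\<close>

lemma weyl_differencing:
  fixes c :: "nat \<Rightarrow> int"
  assumes "c j = 0" "A \<subseteq> {1..int L}"
    and "\<And>x. x \<in> A \<Longrightarrow> 2 ^ j dvd x"
    and "\<And>x. x \<in> A \<Longrightarrow> near_multiple m R (\<Sum>n\<le>Suc j. c n * x ^ n)"
  shows "real (card A) ^ 2 ^ j * real (2 * L + 1) ^ Suc j \<le>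
    real (2 * L + 1) ^ 2 ^ j * real (card (cubes j L m R (c (Suc j))))"
  using assms
proof (induction j arbitrary: c A R)
  case 0
  have "inj_on (\<lambda>y. ([]::int list, y)) A"
    by (auto simp: inj_on_def)
  moreover have "(\<lambda>y. ([], y)) ` A \<subseteq> cubes 0 L m R (c (Suc 0))"
    using 0 by (auto simp: cubes_def)
  ultimately have "card A \<le> card (cubes 0 L m R (c (Suc 0)))"
    by (meson card_inj_on_le finite_cubes)
  then have "real (card A) * real (2 * L + 1) \<le> real (card (cubes 0 L m R (c (Suc 0)))) * real (2 * L + 1)"
    by (intro mult_right_mono) auto
  then show ?case
    by (simp add: mult_ac)
next
  case (Suc j)
  define W where "W = real (2 * L + 1)"
  define I where "I = {- int L..int L}"
  define B where "B h = {y. y + h \<in> A \<and> y - h \<in> A}" for h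
  define c' where "c' h i = (\<Sum>n\<le>Suc (Suc j). c n * (of_nat (n choose i) * (h ^ (n - i) - (- h) ^ (n - i))))"
    for h i
  have W: "W = real (card I)"
    by (simp add: W_def I_def)
  have W0: "W \<ge> 0"
    by (simp add: W_def)
  have finA: "finite A"
    using Suc.prems(2) finite_subset by blast
  have BL: "B h \<subseteq> {1..int L}" for h
  proof
    fix y assume "y \<in> B h"
    then have "y + h \<in> {1..int L}" "y - h \<in> {1..int L}"
      using Suc.prems(2) by (auto simp: B_def)
    then show "y \<in> {1..int L}" by auto
  qed
  have finB: "finite (B h)" for h
    using BL finite_subset by blast
  \<comment> \<open>Twice a midpoint is a sum of two multiples of \<open>2 ^ Suc j\<close>; halving
    costs one power of 2, exactly what the next step can spare.\<close>
  have dvdB: "2 ^ j dvd y" if "y \<in> B h" for y h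
  proof -
    have "2 ^ Suc j dvd (y + h) + (y - h)"
      using that by (intro dvd_add Suc.prems(3)) (auto simp: B_def)
    then show ?thesis by simp
  qed
  have IH: "real (card (B h)) ^ 2 ^ j * W ^ Suc j \<le> W ^ 2 ^ j * real (card (cubes j L m (2 * R) (c' h (Suc j))))"
    for h
    unfolding W_def
  proof (rule Suc.IH[OF _ BL dvdB])
    show "c' h j = 0"
      using central_difference_coeffs(2)[of c "Suc j" h] Suc.prems(1) by (simp add: c'_def)
    fix y assume y: "y \<in> B h"
    have "near_multiple m (2 * R) ((\<Sum>n\<le>Suc (Suc j). c n * (y + h) ^ n) - (\<Sum>n\<le>Suc (Suc j). c n * (y - h) ^ n))"
      using y by (intro near_multiple_diff Suc.prems(4)) (auto simp: B_def)
    then show "near_multiple m (2 * R) (\<Sum>n\<le>Suc j. c' h n * y ^ n)"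
      using central_difference_coeffs(1)[of c "Suc j" y h] Suc.prems(1) by (simp add: c'_def)
  qed
  have c'_lead: "c' h (Suc j) = 2 * of_nat (Suc (Suc j)) * h * c (Suc (Suc j))" for h
    using central_difference_coeffs(3)[of c "Suc j" h] Suc.prems(1) by (simp add: c'_def)
  have F: "(fact (Suc j + 1) :: int) = of_nat (Suc (Suc j)) * fact (j + 1)"
    by simp
  \<comment> \<open>A pair is recovered from its half difference and midpoint as their sum and
    difference; evenness of the points makes both integral.\<close>
  have "card (A \<times> A) \<le> card (Sigma I B)"
  proof (rule card_inj_on_le)
    have ev: "\<exists>x'. x = 2 * x'" if "x \<in> A" for x
      using Suc.prems(3)[OF that] by (auto elim!: dvdE)
    have half: "(2 * u - 2 * v) div 2 = u - v" "(2 * u + 2 * v) div 2 = u + v" for u v :: int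
      by (metis nonzero_mult_div_cancel_left right_diff_distrib zero_neq_numeral)
         (metis nonzero_mult_div_cancel_left distrib_left zero_neq_numeral)
    show "inj_on (\<lambda>(x, y). ((x - y) div 2, (x + y) div 2)) (A \<times> A)"
    proof (rule inj_onI, clarify)
      fix x y u v assume "x \<in> A" "y \<in> A" "u \<in> A" "v \<in> A"
        and eq: "(x - y) div 2 = (u - v) div 2" "(x + y) div 2 = (u + v) div 2"
      then obtain x' y' u' v' where e: "x = 2 * x'" "y = 2 * y'" "u = 2 * u'" "v = 2 * v'"
        using ev by metis
      show "x = u \<and> y = v"
        using eq unfolding e half by simp
    qed
    show "(\<lambda>(x, y). ((x - y) div 2, (x + y) div 2)) ` (A \<times> A) \<subseteq> Sigma I B"
    proof clarify
      fix x y assume xy: "x \<in> A" "y \<in> A"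
      obtain x' y' where e: "x = 2 * x'" "y = 2 * y'"
        using ev xy by blast
      have "x \<in> {1..int L}" "y \<in> {1..int L}"
        using Suc.prems(2) xy by auto
      then show "(x - y) div 2 \<in> I \<and> (x + y) div 2 \<in> B ((x - y) div 2)"
        using xy unfolding e half by (auto simp: I_def B_def)
    qed
  qed (simp add: I_def finB)
  then have "card A * card A \<le> (\<Sum>h\<in>I. card (B h))"
    by (subst (asm) card_SigmaI) (auto simp: card_cartesian_product finB I_def)
  then have AA: "(real (card A))\<^sup>2 \<le> (\<Sum>h\<in>I. real (card (B h)))"
    unfolding power2_eq_square of_nat_mult[symmetric] of_nat_sum[symmetric] of_nat_le_iff .
  \<comment> \<open>The factor \<open>2 * (j + 2) * h\<close> in the new leading coefficient turns
    \<open>2 ^ j * fact (j + 1)\<close> into \<open>2 ^ (j + 1) * fact (j + 2)\<close> and puts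
    \<open>h\<close> into the product, so cubes for different \<open>h\<close> become disjoint
    families of cubes with one more side.\<close>
  have T: "(\<Sum>h\<in>I. card (cubes j L m (2 * R) (c' h (Suc j)))) \<le> card (cubes (Suc j) L m R (c (Suc (Suc j))))"
  proof -
    have "card (Sigma I (\<lambda>h. cubes j L m (2 * R) (c' h (Suc j)))) \<le> card (cubes (Suc j) L m R (c (Suc (Suc j))))"
    proof (rule card_inj_on_le)
      show "inj_on (\<lambda>(h, hs, y). (h # hs, y)) (Sigma I (\<lambda>h. cubes j L m (2 * R) (c' h (Suc j))))"
        by (auto simp: inj_on_def)
      show "(\<lambda>(h, hs, y). (h # hs, y)) ` (Sigma I (\<lambda>h. cubes j L m (2 * R) (c' h (Suc j)))) \<subseteq>
          cubes (Suc j) L m R (c (Suc (Suc j)))"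
      proof clarify
        fix h hs y assume h: "h \<in> I" and hs: "(hs, y) \<in> cubes j L m (2 * R) (c' h (Suc j))"
        have e1: "(2::int) ^ Suc j * fact (Suc j + 1) * c (Suc (Suc j)) * prod_list (h # hs) * y =
              2 ^ j * fact (j + 1) * c' h (Suc j) * prod_list hs * y"
          unfolding c'_lead F prod_list.Cons power_Suc by (simp only: mult_ac)
        have e2: "2 ^ Suc j * R = 2 ^ j * (2 * R)"
          by simp
        show "(h # hs, y) \<in> cubes (Suc j) L m R (c (Suc (Suc j)))"
          using h hs by (auto simp only: cubes_def I_def mem_Collect_eq case_prod_conv e1 e2
              length_Cons list.set insert_subset)
      qed
    qed (rule finite_cubes)
    then show ?thesis
      by (subst (asm) card_SigmaI) (auto simp: finite_cubes I_def)
  qed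
  \<comment> \<open>Of the \<open>j + 2\<close> factors \<open>W\<close>, one pays for the power
    mean over \<open>h\<close> and the other \<open>j + 1\<close> feed the induction
    hypothesis.\<close>
  have "real (card A) ^ 2 ^ Suc j * W ^ Suc (Suc j) = ((real (card A))\<^sup>2) ^ 2 ^ j * W * W ^ Suc j"
    by (simp add: power_mult)
  also have "\<dots> \<le> (\<Sum>h\<in>I. real (card (B h))) ^ 2 ^ j * W * W ^ Suc j"
    using W0 by (intro mult_right_mono power_mono AA) auto
  also have "\<dots> \<le> W ^ 2 ^ j * (\<Sum>h\<in>I. real (card (B h)) ^ 2 ^ j) * W ^ Suc j"
    unfolding W by (intro mult_right_mono power_mean_two_power) auto
  also have "\<dots> = W ^ 2 ^ j * (\<Sum>h\<in>I. real (card (B h)) ^ 2 ^ j * W ^ Suc j)"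
    by (simp add: sum_distrib_right)
  also have "\<dots> \<le> W ^ 2 ^ j * (\<Sum>h\<in>I. W ^ 2 ^ j * real (card (cubes j L m (2 * R) (c' h (Suc j)))))"
    using W0 by (intro mult_left_mono sum_mono IH) auto
  also have "\<dots> = W ^ 2 ^ Suc j * real (\<Sum>h\<in>I. card (cubes j L m (2 * R) (c' h (Suc j))))"
  proof -
    have "W ^ 2 ^ Suc j = W ^ 2 ^ j * W ^ 2 ^ j"
      by (simp add: power_add[symmetric] mult_2[symmetric])
    then show ?thesis
      by (simp only: sum_distrib_left[symmetric] of_nat_sum mult.assoc)
  qed
  also have "\<dots> \<le> W ^ 2 ^ Suc j * real (card (cubes (Suc j) L m R (c (Suc (Suc j)))))"
    using T W0 by (intro mult_left_mono) (auto simp del: of_nat_sum)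
  finally show ?case
    by (simp add: W_def)
qed

section \<open>Counting cubes and close fractions\<close>

text \<open>Members of one residue class are determined by their quotients by \<open>m\<close>. The
  summand 2 consists of 1 for counting both end quotients and 1 for rounding down at
  \<open>a\<close>.\<close>

lemma card_congruent_le:
  fixes S :: "int set" and a b m :: int
  assumes "S \<subseteq> {a..b}" "m > 0" "a \<le> b" "\<And>x y. x \<in> S \<Longrightarrow> y \<in> S \<Longrightarrow> m dvd x - y"
  shows "real (card S) \<le> (real_of_int b - real_of_int a) / real_of_int m + 2"
proof -
  have inj: "inj_on (\<lambda>x. x div m) S"
  proof (rule inj_onI)
    fix x y assume "x \<in> S" "y \<in> S" "x div m = y div m"
    moreover from this have "x mod m = y mod m"
      using assms(4) by (simp add: mod_eq_dvd_iff)
    ultimately show "x = y"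
      by (metis div_mult_mod_eq)
  qed
  have "(\<lambda>x. x div m) ` S \<subseteq> {a div m..b div m}"
    using assms(1,2) by (auto intro!: zdiv_mono1)
  then have "card S \<le> card {a div m..b div m}"
    using inj card_inj_on_le by blast
  then have "real (card S) \<le> real (nat (b div m - a div m + 1))"
    by simp
  also have "\<dots> = real_of_int (b div m) - real_of_int (a div m) + 1"
  proof -
    have "a div m \<le> b div m"
      using assms(2,3) by (intro zdiv_mono1) auto
    then show ?thesis by simp
  qed
  also have "\<dots> \<le> real_of_int b / real_of_int m - (real_of_int a / real_of_int m - 1) + 1"
    using real_of_int_div3[of a m]
    by (intro add_mono diff_mono) (auto simp: real_of_int_div4)
  finally show ?thesis
    by (simp add: diff_divide_distrib)
qed

text \<open>The product \<open>b * v\<close> falls into one of at most \<open>2 * R + 1\<close>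
  residues modulo \<open>m\<close>, and since \<open>b\<close> is invertible modulo \<open>m\<close>
  each residue fixes the class of \<open>v\<close>.\<close>

lemma card_near_multiple_le:
  fixes b m Z :: int
  assumes "coprime b m" "m > 0" "R \<ge> 0" "Z \<ge> 0"
  shows "real (card {v \<in> {- Z..Z}. near_multiple m R (b * v)}) \<le>
    (2 * R + 1) * (2 * (real_of_int Z / real_of_int m) + 2)"
proof -
  define S where "S r = {v \<in> {- Z..Z}. m dvd b * v - r}" for r
  define I where "I = {- \<lfloor>R\<rfloor>..\<lfloor>R\<rfloor>}"
  have sub: "{v \<in> {- Z..Z}. near_multiple m R (b * v)} \<subseteq> (\<Union>r\<in>I. S r)"
  proof
    fix v assume "v \<in> {v \<in> {- Z..Z}. near_multiple m R (b * v)}"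
    then obtain t where v: "v \<in> {- Z..Z}" and t: "\<bar>real_of_int (b * v - t * m)\<bar> \<le> R"
      by (auto simp: near_multiple_def)
    have "b * v - t * m \<in> I"
    proof -
      have "b * v - t * m \<le> \<lfloor>R\<rfloor>" "- (b * v - t * m) \<le> \<lfloor>R\<rfloor>"
        unfolding le_floor_iff using t by auto
      then show ?thesis by (simp add: I_def)
    qed
    moreover have "v \<in> S (b * v - t * m)"
      using v by (simp add: S_def)
    ultimately show "v \<in> (\<Union>r\<in>I. S r)" by blast
  qed
  have S: "real (card (S r)) \<le> 2 * (real_of_int Z / real_of_int m) + 2" for r
  proof -
    have "real (card (S r)) \<le> (real_of_int Z - real_of_int (- Z)) / real_of_int m + 2"
    proof (rule card_congruent_le)
      fix x y assume "x \<in> S r" "y \<in> S r"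
      then have "m dvd (b * x - r) - (b * y - r)"
        using dvd_diff unfolding S_def by blast
      then have "m dvd b * (x - y)"
        by (simp add: algebra_simps)
      then show "m dvd x - y"
        using assms(1) by (simp add: coprime_commute coprime_dvd_mult_right_iff)
    qed (use assms in \<open>auto simp: S_def\<close>)
    then show ?thesis by simp
  qed
  have "card {v \<in> {- Z..Z}. near_multiple m R (b * v)} \<le> card (\<Union>r\<in>I. S r)"
  proof (rule card_mono[OF _ sub])
    have "finite (S r)" for r
      by (rule finite_subset[of _ "{- Z..Z}"]) (auto simp: S_def)
    then show "finite (\<Union>r\<in>I. S r)"
      by (simp add: I_def)
  qed
  also have "\<dots> \<le> (\<Sum>r\<in>I. card (S r))"
    by (rule card_UN_le) (auto simp: I_def)
  finally have "real (card {v \<in> {- Z..Z}. near_multiple m R (b * v)}) \<le> (\<Sum>r\<in>I. real (card (S r)))"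
    unfolding of_nat_sum[symmetric] of_nat_le_iff .
  also have "\<dots> \<le> real (card I) * (2 * (real_of_int Z / real_of_int m) + 2)"
    by (rule sum_bounded_above) (rule S)
  also have "real (card I) \<le> 2 * R + 1"
  proof -
    have "\<lfloor>R\<rfloor> \<ge> 0"
      using assms by simp
    then have "real (card I) = 2 * real_of_int \<lfloor>R\<rfloor> + 1"
      by (simp add: I_def)
    then show ?thesis by linarith
  qed
  then have "real (card I) * (2 * (real_of_int Z / real_of_int m) + 2) \<le>
      (2 * R + 1) * (2 * (real_of_int Z / real_of_int m) + 2)"
    using assms by (intro mult_right_mono) auto
  finally show ?thesis .
qed

text \<open>A union bound over the position of a zero entry, obtained by splitting on whether the
  head or the tail contains it. Multiplying by \<open>card I\<close> avoids the exponent
  \<open>j - 1\<close>.\<close>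

lemma card_lists_with_zero:
  fixes I :: "int set"
  assumes "finite I" "0 \<in> I"
  shows "card {hs. length hs = j \<and> set hs \<subseteq> I \<and> 0 \<in> set hs} * card I \<le> j * card I ^ j"
proof (induction j)
  case 0
  then show ?case by simp
next
  case (Suc j)
  define Y where "Y j = {hs. length hs = j \<and> set hs \<subseteq> I \<and> 0 \<in> set hs}" for j
  define X where "X = {hs. set hs \<subseteq> I \<and> length hs = j}"
  have finX: "finite X"
    using assms finite_lists_length_eq by (auto simp: X_def)
  have finY: "finite (Y j)"
    by (rule finite_subset[OF _ finX]) (auto simp: X_def Y_def)
  have "Y (Suc j) \<subseteq> (\<lambda>hs. 0 # hs) ` X \<union> (\<lambda>(h, hs). h # hs) ` (I \<times> Y j)"
    by (force simp: X_def Y_def length_Suc_conv image_iff)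
  then have "card (Y (Suc j)) \<le> card ((\<lambda>hs. 0 # hs) ` X \<union> (\<lambda>(h, hs). h # hs) ` (I \<times> Y j))"
    using finX finY assms by (intro card_mono) auto
  also have "\<dots> \<le> card ((\<lambda>hs. 0 # hs) ` X) + card ((\<lambda>(h, hs). h # hs) ` (I \<times> Y j))"
    by (rule card_Un_le)
  also have "\<dots> \<le> card X + card (I \<times> Y j)"
    using finX finY assms by (intro add_mono card_image_le) auto
  also have "\<dots> = card I ^ j + card I * card (Y j)"
    using assms by (simp add: X_def card_lists_length_eq card_cartesian_product)
  finally have "card (Y (Suc j)) * card I \<le> (card I ^ j + card I * card (Y j)) * card I"
    by (rule mult_right_mono) simp
  also have "\<dots> = card I ^ Suc j + card I * (card (Y j) * card I)"
    by (simp add: algebra_simps)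
  also have "\<dots> \<le> card I ^ Suc j + card I * (j * card I ^ j)"
    using Suc by (intro add_left_mono mult_left_mono) (auto simp: Y_def)
  finally show ?case
    by (simp add: Y_def algebra_simps)
qed

lemma card_int_divisors_le:
  fixes l :: int
  assumes "l \<noteq> 0"
  shows "finite {d. d dvd l}" "card {d. d dvd l} \<le> 2 * card {d. d dvd nat \<bar>l\<bar>}"
proof -
  define S where "S = {d. d dvd nat \<bar>l\<bar>}"
  have finS: "finite S"
    unfolding S_def using assms by (intro finite_divisors_nat) simp
  have sub: "{d. d dvd l} \<subseteq> int ` S \<union> (\<lambda>d. - int d) ` S"
  proof
    fix d assume "d \<in> {d. d dvd l}"
    then have "nat \<bar>d\<bar> \<in> S"
      by (simp add: S_def nat_dvd_iff)
    moreover have "d = int (nat \<bar>d\<bar>) \<or> d = - int (nat \<bar>d\<bar>)"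
      by linarith
    ultimately show "d \<in> int ` S \<union> (\<lambda>d. - int d) ` S" by blast
  qed
  show "finite {d. d dvd l}"
    using finite_subset[OF sub] finS by simp
  have "card {d. d dvd l} \<le> card (int ` S \<union> (\<lambda>d. - int d) ` S)"
    using finS by (intro card_mono sub) auto
  also have "\<dots> \<le> card (int ` S) + card ((\<lambda>d. - int d) ` S)"
    by (rule card_Un_le)
  also have "\<dots> \<le> card S + card S"
    using finS by (intro add_mono card_image_le)
  finally show "card {d. d dvd l} \<le> 2 * card {d. d dvd nat \<bar>l\<bar>}"
    by (simp add: S_def)
qed

lemma abs_prod_list_le:
  fixes hs :: "int list"
  assumes "set hs \<subseteq> {- L..L}" "L \<ge> 0"
  shows "\<bar>prod_list hs\<bar> \<le> L ^ length hs"
  using assms(1)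
proof (induction hs)
  case (Cons h hs)
  then have "\<bar>h\<bar> * \<bar>prod_list hs\<bar> \<le> L * L ^ length hs"
    using assms(2) by (intro mult_mono) auto
  then show ?case by (simp add: abs_mult)
qed simp

text \<open>The first summand counts cubes with a vanishing side. The others are sorted by the
  integer \<open>v\<close> that multiplies \<open>b\<close>: coprimality of \<open>b\<close> and
  \<open>m\<close> limits the number of values \<open>v\<close>, and the divisor bound limits the
  cubes sharing one value.\<close>

lemma card_cubes_le:
  fixes m b :: int
  assumes "coprime b m" "m > 0" "R \<ge> 0" "L \<ge> 1"
    and D: "\<And>n. n \<in> {1..L ^ Suc j} \<Longrightarrow> real (card {d. d dvd n}) \<le> D"
  shows "real (card (cubes j L m R b)) \<le> real j * real (2 * L + 1) ^ j +
    (2 * D) ^ j * ((2 * (2 ^ j * R) + 1) * (2 * (2 ^ j * fact (j + 1) * real L ^ Suc j / real_of_int m) + 2))"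
proof -
  define I where "I = {- int L..int L}"
  define W where "W = card I"
  have W: "W = 2 * L + 1"
    by (simp add: W_def I_def)
  \<comment> \<open>This constant may share factors with \<open>m\<close>, so it is counted as part
    of \<open>v\<close>, and only the coprime factor \<open>b\<close> is inverted.\<close>
  define c0 :: int where "c0 = 2 ^ j * fact (j + 1)"
  have c0: "c0 > 0"
    by (simp add: c0_def)
  define Z where "Z = c0 * int L ^ Suc j"
  define V where "V = {v \<in> {- Z..Z}. near_multiple m (2 ^ j * R) (b * v)}"
  define Y where "Y = {hs. length hs = j \<and> set hs \<subseteq> I \<and> 0 \<in> set hs}"
  define T1 where "T1 = {(hs, y) \<in> cubes j L m R b. prod_list hs \<noteq> 0}"
  define F where "F v = {(hs, y) \<in> T1. c0 * (prod_list hs * y) = v}" for v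
  have finY: "finite Y"
    by (rule finite_subset[of _ "{hs. set hs \<subseteq> I \<and> length hs = j}"])
       (auto simp: Y_def I_def intro!: finite_lists_length_eq)
  have finT1: "finite T1"
    by (rule finite_subset[OF _ finite_cubes[of j L m R b]]) (auto simp: T1_def)
  have D0: "D \<ge> 0"
    using D[of 1] assms(4) by simp
  have "cubes j L m R b \<subseteq> Y \<times> {1..int L} \<union> T1"
    by (auto simp: cubes_def Y_def T1_def I_def prod_list_zero_iff)
  then have "card (cubes j L m R b) \<le> card (Y \<times> {1..int L} \<union> T1)"
    using finY finT1 by (intro card_mono) auto
  also have "\<dots> \<le> card (Y \<times> {1..int L}) + card T1"
    by (rule card_Un_le)
  also have "card (Y \<times> {1..int L}) = card Y * L"
    by (simp add: card_cartesian_product)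
  also have "card Y * L \<le> card Y * W"
    by (simp add: W)
  also have "\<dots> \<le> j * W ^ j"
    unfolding W_def Y_def by (rule card_lists_with_zero) (auto simp: I_def)
  finally have 1: "card (cubes j L m R b) \<le> j * W ^ j + card T1" by simp
  have abs_l: "\<bar>prod_list hs * y\<bar> \<le> int L ^ Suc j" if "(hs, y) \<in> cubes j L m R b" for hs y
  proof -
    have "\<bar>prod_list hs\<bar> * \<bar>y\<bar> \<le> int L ^ j * int L"
      using that abs_prod_list_le[of hs "int L"] by (intro mult_mono) (auto simp: cubes_def)
    then show ?thesis
      by (simp add: abs_mult mult_ac)
  qed
  have "T1 \<subseteq> (\<Union>v\<in>V. F v)"
  proof clarify
    fix hs y assume t: "(hs, y) \<in> T1"
    then have c: "(hs, y) \<in> cubes j L m R b"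
      by (simp add: T1_def)
    have "\<bar>c0 * (prod_list hs * y)\<bar> \<le> Z"
      using abs_l[OF c] c0 by (simp add: Z_def abs_mult)
    moreover have "near_multiple m (2 ^ j * R) (b * (c0 * (prod_list hs * y)))"
      using c unfolding cubes_def c0_def by (simp only: mem_Collect_eq case_prod_conv mult_ac)
    ultimately have "c0 * (prod_list hs * y) \<in> V"
      by (simp add: V_def abs_le_iff)
    then show "(hs, y) \<in> (\<Union>v\<in>V. F v)"
      using t by (auto simp: F_def)
  qed
  then have "card T1 \<le> card (\<Union>v\<in>V. F v)"
    by (intro card_mono finite_subset[OF _ finT1]) (auto simp: F_def)
  also have "\<dots> \<le> (\<Sum>v\<in>V. card (F v))"
    by (rule card_UN_le, rule finite_subset[of _ "{- Z..Z}"]) (auto simp: V_def)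
  finally have "real (card T1) \<le> (\<Sum>v\<in>V. real (card (F v)))"
    unfolding of_nat_sum[symmetric] of_nat_le_iff .
  also have "\<dots> \<le> real (card V) * (2 * D) ^ j"
  proof (rule sum_bounded_above)
    fix v
    show "real (card (F v)) \<le> (2 * D) ^ j"
    proof (cases "F v = {}")
      case True
      then show ?thesis
        using D0 by simp
    next
      case False
      then obtain hs0 y0 where h0: "(hs0, y0) \<in> T1" "c0 * (prod_list hs0 * y0) = v"
        by (auto simp: F_def)
      define l where "l = prod_list hs0 * y0"
      have c: "(hs0, y0) \<in> cubes j L m R b"
        using h0 by (simp add: T1_def)
      have l0: "l \<noteq> 0"
        using h0(1) c by (auto simp: l_def T1_def cubes_def)
      have "\<bar>l\<bar> \<le> int L ^ Suc j"
        using abs_l[OF c] by (simp add: l_def)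
      then have "nat \<bar>l\<bar> \<le> L ^ Suc j"
        by (metis nat_le_iff of_nat_power)
      then have Dl: "real (card {d. d dvd nat \<bar>l\<bar>}) \<le> D"
        using l0 by (intro D) auto
      have Fl: "prod_list hs * y = l" if "(hs, y) \<in> F v" for hs y
        using that h0(2) c0 by (auto simp: F_def l_def)
      \<comment> \<open>All sides divide the nonzero number \<open>l\<close>, with at most
        \<open>2 * D\<close> signed choices each, and the sides then determine
        \<open>y\<close>.\<close>
      have "card (F v) \<le> card {hs. set hs \<subseteq> {d. d dvd l} \<and> length hs = j}"
      proof (rule card_inj_on_le)
        show "inj_on fst (F v)"
        proof (rule inj_onI)
          fix s t assume s: "s \<in> F v" and t: "t \<in> F v" and eq: "fst s = fst t"
          obtain hs y z where e: "s = (hs, y)" "t = (hs, z)"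
            using eq by (metis prod.collapse)
          have "prod_list hs * y = l" "prod_list hs * z = l"
            using Fl s t unfolding e by blast+
          then show "s = t"
            using l0 unfolding e by auto
        qed
        show "fst ` F v \<subseteq> {hs. set hs \<subseteq> {d. d dvd l} \<and> length hs = j}"
        proof clarsimp
          fix hs y assume a: "(hs, y) \<in> F v"
          have "x dvd l" if "x \<in> set hs" for x
            using Fl[OF a] prod_list_dvd[OF that] by (metis dvd_mult2)
          then show "set hs \<subseteq> {d. d dvd l} \<and> length hs = j"
            using a by (auto simp: F_def T1_def cubes_def)
        qed
      qed (use card_int_divisors_le[OF l0] finite_lists_length_eq in blast)
      also have "\<dots> = card {d. d dvd l} ^ j"
        using card_int_divisors_le[OF l0] by (simp add: card_lists_length_eq)
      finally have "real (card (F v)) \<le> real (card {d. d dvd l}) ^ j"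
        unfolding of_nat_power[symmetric] of_nat_le_iff .
      also have "\<dots> \<le> (2 * D) ^ j"
        using card_int_divisors_le(2)[OF l0] Dl by (intro power_mono) auto
      finally show ?thesis .
    qed
  qed
  also have "\<dots> \<le> ((2 * (2 ^ j * R) + 1) * (2 * (real_of_int Z / real_of_int m) + 2)) * (2 * D) ^ j"
    unfolding V_def using assms c0 D0
    by (intro mult_right_mono card_near_multiple_le) (auto simp: Z_def)
  finally have 2: "real (card T1) \<le>
      (2 * D) ^ j * ((2 * (2 ^ j * R) + 1) * (2 * (real_of_int Z / real_of_int m) + 2))"
    by (simp only: mult_ac)
  have "real (card (cubes j L m R b)) \<le> real (j * W ^ j) + real (card T1)"
    unfolding of_nat_add[symmetric] of_nat_le_iff by (rule 1)
  also note 2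
  finally show ?thesis
    by (simp add: W Z_def c0_def)
qed

section \<open>Fractions in an arc of length \<open>1 / N\<close>\<close>

text \<open>Weyl differencing is applied to \<open>b' * x ^ k\<close> modulo \<open>p ^ k\<close>,
  where \<open>b' / p ^ k\<close> has the largest denominator. The condition
  \<open>Q ^ k \<le> N\<close> makes the numerator a function of \<open>q\<close> within the arc and
  turns divisor losses in \<open>p\<close> into \<open>N powr \<delta>\<close>.\<close>

lemma card_close_fractions:
  fixes k :: nat and \<delta> :: real
  assumes "k \<ge> 2" "\<delta> > 0"
  defines "\<kappa> \<equiv> (2::nat) ^ (k - 1)"
  obtains C where "C > 0"
    "\<And>(Q::nat) (N::nat) X. Q ^ k \<le> N \<Longrightarrow> X \<subseteq> Sigma {1..Q} (coprime_residues k) \<Longrightarrow>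
      (\<And>q b q' b'. (q, b) \<in> X \<Longrightarrow> (q', b') \<in> X \<Longrightarrow>
        \<exists>z::int. \<bar>real b / real q ^ k - real b' / real q' ^ k - z\<bar> < 1 / real N) \<Longrightarrow>
      real (card X) ^ \<kappa> \<le> C * real N powr \<delta> * (real Q ^ (\<kappa> - 1) + real Q ^ (\<kappa> + k) / real N)"
proof -
  define j where "j = k - 1"
  have k: "k = Suc j" and j0: "j > 0"
    using assms(1) by (auto simp: j_def)
  have \<kappa>: "\<kappa> = 2 ^ j"
    by (simp add: \<kappa>_def j_def)
  have k\<kappa>: "k \<le> \<kappa>"
    unfolding \<kappa> k by (simp add: Suc_leI)
  have \<delta>j: "\<delta> / real j > 0"
    using assms j0 by simp
  \<comment> \<open>The exponent is divided by \<open>j\<close> because the divisor bound enters to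
    the power \<open>j\<close>, once for each side of a cube.\<close>
  obtain Cd where Cd: "Cd \<ge> 1" "\<And>n::nat. n > 0 \<Longrightarrow> real (card {d. d dvd n}) \<le> Cd * real n powr (\<delta> / real j)"
    using divisor_bound[OF \<delta>j] by blast
  define G where "G = (2 * Cd) ^ j * (2 ^ (j * k)) powr \<delta>"
  define E :: real where "E = 2 * (2 ^ j * fact k * 2 ^ (j * k)) + 2"
  define F :: real where "F = 2 * (2 ^ j * 2 ^ (j * k))"
  \<comment> \<open>Matches \<open>W = 2 * 2 ^ j * p + 1 \<le> w * p\<close> below.\<close>
  define w :: real where "w = 3 * 2 ^ j"
  define C where "C = w ^ \<kappa> * (real j + G * E * F)"
  have G0: "G > 0" and E0: "E > 0" and F1: "F \<ge> 1" and w1: "w \<ge> 1"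
  proof -
    have "(1::real) \<le> 2 ^ j" "(1::real) \<le> 2 ^ (j * k)"
      by simp_all
    then have "(1::real) * 1 \<le> 2 ^ j * 2 ^ (j * k)"
      by (intro mult_mono) auto
    then show "F \<ge> 1"
      unfolding F_def by simp
    show "w \<ge> 1"
      using \<open>(1::real) \<le> 2 ^ j\<close> unfolding w_def by linarith
    show "G > 0"
      using Cd by (simp add: G_def)
    show "E > 0"
      by (simp add: E_def add_pos_pos)
  qed
  have "G * E * F > 0"
    using G0 E0 F1 by simp
  then have C0: "C > 0"
    unfolding C_def using w1 by (intro mult_pos_pos[OF _ add_nonneg_pos]) auto
  have main: "real (card X) ^ \<kappa> \<le> C * real N powr \<delta> * (real Q ^ (\<kappa> - 1) + real Q ^ (\<kappa> + k) / real N)"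
    if QN: "Q ^ k \<le> N" and X: "X \<subseteq> Sigma {1..Q} (coprime_residues k)"
      and close: "\<And>q b q' b'. (q, b) \<in> X \<Longrightarrow> (q', b') \<in> X \<Longrightarrow>
        \<exists>z::int. \<bar>real b / real q ^ k - real b' / real q' ^ k - z\<bar> < 1 / real N"
    for Q N :: nat and X
  proof (cases "X = {}")
    case True
    then show ?thesis
      using C0 by (auto simp: \<kappa> zero_power intro!: mult_nonneg_nonneg add_nonneg_nonneg)
  next
    case False
    define P where "P = fst ` X"
    have finX: "finite X"
      by (rule finite_subset[OF X]) (auto simp: coprime_residues_def)
    have P: "P \<subseteq> {1..Q}" "finite P" "P \<noteq> {}"
      using X finX False by (auto simp: P_def)
    define p where "p = Max P"
    have pP: "p \<in> P"
      using P by (simp add: p_def)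
    have p1: "1 \<le> p" "p \<le> Q"
      using P pP by auto
    have qp: "q \<le> p" "q \<ge> 1" if "(q, b) \<in> X" for q b
    proof -
      have "q \<in> P"
        using that by (force simp: P_def)
      then show "q \<le> p" "q \<ge> 1"
        using P by (auto simp: p_def)
    qed
    have N1: "N \<ge> 1"
      using QN p1 by (metis One_nat_def Suc_leI le_trans nat_zero_less_power_iff zero_less_one not_gr0 le_zero_eq)
    have N0: "real N > 0" "real N \<ge> 1"
      using N1 by auto
    have N\<delta>: "real N powr \<delta> \<ge> 1"
      using N0 assms(2) by (simp add: ge_one_powr_ge_zero)
    obtain b' where b': "(p, b') \<in> X"
      using pP by (auto simp: P_def)
    \<comment> \<open>For equal denominators, multiplying by \<open>q ^ k \<le> N\<close> gives an
      integer of absolute value below 1, hence zero; numerators in \<open>{1..q ^ k}\<close> that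
      are congruent modulo \<open>q ^ k\<close> agree.\<close>
    have inj: "inj_on fst X"
    proof (rule inj_onI)
      fix s t assume st: "s \<in> X" "t \<in> X" "fst s = fst t"
      then obtain q b c where e: "s = (q, b)" "t = (q, c)"
        by (metis prod.collapse)
      have q1: "q \<ge> 1" "q \<le> Q"
        using X st e by auto
      have bc: "b \<in> {1..q ^ k}" "c \<in> {1..q ^ k}"
        using X st e by (auto simp: coprime_residues_def)
      obtain z :: int where z: "\<bar>real b / real q ^ k - real c / real q ^ k - z\<bar> < 1 / real N"
        using close st e by blast
      have qk: "real q ^ k > 0"
        using q1 by simp
      have "q ^ k \<le> N"
        using QN power_mono[OF q1(2)] by (meson le_trans zero_le)
      then have qN: "real q ^ k \<le> real N"
        by (metis of_nat_le_iff of_nat_power)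
      have "\<bar>real b - real c - z * real q ^ k\<bar> = real q ^ k * \<bar>real b / real q ^ k - real c / real q ^ k - z\<bar>"
      proof -
        have "real b - real c - z * real q ^ k = real q ^ k * (real b / real q ^ k - real c / real q ^ k - z)"
          using qk by (simp add: field_simps)
        then show ?thesis
          using qk by (simp add: abs_mult)
      qed
      also have "\<dots> < real q ^ k * (1 / real N)"
        using z qk by (intro mult_strict_left_mono)
      also have "\<dots> \<le> 1"
        using qN N0 by simp
      finally have "\<bar>real_of_int (int b - int c - z * int (q ^ k))\<bar> < 1"
        by simp
      then have "int b - int c = z * int (q ^ k)"
        by linarith
      have "int b \<le> int (q ^ k)" "int c \<le> int (q ^ k)" "int b \<ge> 1" "int c \<ge> 1"
        using bc unfolding of_nat_le_iff by auto
      then have lt: "\<bar>int b - int c\<bar> < int (q ^ k)"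
        by linarith
      have "z = 0"
      proof (rule ccontr)
        assume "z \<noteq> 0"
        then have "1 * int (q ^ k) \<le> \<bar>z\<bar> * int (q ^ k)"
          by (intro mult_right_mono) auto
        also have "\<dots> = \<bar>int b - int c\<bar>"
          unfolding \<open>int b - int c = z * int (q ^ k)\<close> by (simp add: abs_mult)
        finally show False
          using lt by simp
      qed
      then show "s = t"
        using \<open>int b - int c = z * int (q ^ k)\<close> e by simp
    qed
    \<comment> \<open>The denominators are scaled by \<open>2 ^ j\<close> to supply the divisibility
      that differencing requires.\<close>
    define A where "A = (\<lambda>q. 2 ^ j * int q) ` P"
    define L where "L = 2 ^ j * p"
    define m where "m = int (p ^ k)"
    \<comment> \<open>The closeness \<open>1 / N\<close> is multiplied by
      \<open>q ^ k * p ^ k \<le> p ^ (2 * k)\<close> on clearing denominators and by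
      \<open>2 ^ (j * k)\<close> from the scaling.\<close>
    define R where "R = 2 ^ (j * k) * (real p ^ (2 * k) / real N)"
    define W where "W = real (2 * L + 1)"
    define c where "c n = (if n = k then int b' else 0)" for n
    have L1: "L \<ge> 1"
      using p1 by (simp add: L_def)
    have m0: "m > 0"
      using p1 by (simp add: m_def)
    have R0: "R \<ge> 0"
      by (simp add: R_def)
    have W1: "W \<ge> 1"
      by (simp add: W_def)
    have cardA: "card A = card X"
      unfolding A_def P_def using inj
      by (subst card_image) (auto simp: inj_on_def card_image)
    have "real (card A) ^ 2 ^ j * real (2 * L + 1) ^ Suc j \<le>
        real (2 * L + 1) ^ 2 ^ j * real (card (cubes j L m R (c (Suc j))))"
    proof (rule weyl_differencing)
      show "c j = 0"
        by (simp add: c_def k)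
      show "A \<subseteq> {1..int L}"
      proof
        fix x assume "x \<in> A"
        then obtain q where q: "q \<in> P" "x = 2 ^ j * int q"
          by (auto simp: A_def)
        have "int q \<ge> 1" "int q \<le> int p"
          using q P by (auto simp: p_def)
        then have "1 * 1 \<le> 2 ^ j * int q" "2 ^ j * int q \<le> 2 ^ j * int p"
          by (intro mult_mono; simp)+
        then show "x \<in> {1..int L}"
          by (simp add: q L_def)
      qed
      fix x assume "x \<in> A"
      then obtain q b where q: "(q, b) \<in> X" "x = 2 ^ j * int q"
        by (auto simp: A_def P_def)
      then show "2 ^ j dvd x" by simp
      obtain z :: int where z: "\<bar>real b / real q ^ k - real b' / real p ^ k - z\<bar> < 1 / real N"
        using close[OF q(1) b'] by blast
      have q0: "real q > 0" "real p > 0" "real q \<le> real p"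
        using qp[OF q(1)] p1 by auto
      \<comment> \<open>The multiple of \<open>m\<close> comes from the nearby fraction: clearing
        denominators in \<open>b / q ^ k - b' / p ^ k - z\<close> leaves \<open>b' * q ^ k\<close>
        minus \<open>p ^ k * (b - z * q ^ k)\<close>, up to sign.\<close>
      define t where "t = 2 ^ (j * k) * (int b - z * int q ^ k)"
      have "real_of_int (int b' * x ^ k - t * m) =
          - (2 ^ (j * k) * (real q ^ k * real p ^ k)) * (real b / real q ^ k - real b' / real p ^ k - z)"
        using q0 by (simp add: q t_def m_def power_mult_distrib power_mult field_simps)
      then have "\<bar>real_of_int (int b' * x ^ k - t * m)\<bar> =
          2 ^ (j * k) * (real q ^ k * real p ^ k) * \<bar>real b / real q ^ k - real b' / real p ^ k - z\<bar>"
        by (simp add: abs_mult)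
      also have "\<dots> \<le> 2 ^ (j * k) * (real p ^ k * real p ^ k) * (1 / real N)"
        using q0 z by (intro mult_mono mult_left_mono power_mono) auto
      also have "\<dots> = R"
        by (simp add: R_def power_add mult_2)
      finally have "near_multiple m R (int b' * x ^ k)"
        unfolding near_multiple_def by blast
      then show "near_multiple m R (\<Sum>n\<le>Suc j. c n * x ^ n)"
        by (simp add: c_def k)
    qed
    moreover have "c (Suc j) = int b'"
      by (simp add: c_def k)
    ultimately have "real (card X) ^ \<kappa> * W ^ k \<le> W ^ \<kappa> * real (card (cubes j L m R (int b')))"
      by (simp only: \<kappa> k W_def cardA)
    also have "W ^ \<kappa> = W ^ (\<kappa> - k) * W ^ k"
      using k\<kappa> by (simp flip: power_add)
    finally have "real (card X) ^ \<kappa> * W ^ k \<le> W ^ (\<kappa> - k) * real (card (cubes j L m R (int b'))) * W ^ k"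
      by (simp only: mult_ac)
    then have 1: "real (card X) ^ \<kappa> \<le> W ^ (\<kappa> - k) * real (card (cubes j L m R (int b')))"
      using W1 by (simp add: mult_le_cancel_right)
    define D where "D = Cd * (real L ^ k) powr (\<delta> / real j)"
    have "real (card (cubes j L m R (int b'))) \<le> real j * real (2 * L + 1) ^ j +
      (2 * D) ^ j * ((2 * (2 ^ j * R) + 1) * (2 * (2 ^ j * fact (j + 1) * real L ^ Suc j / real_of_int m) + 2))"
    proof (rule card_cubes_le)
      have "gcd b' p = 1"
        using b' X by (auto simp: coprime_residues_def)
      then have "coprime (int b') (int p)"
        by (simp add: coprime_iff_gcd_eq_1)
      then show "coprime (int b') m"
        by (simp add: m_def)
      fix n assume n: "n \<in> {1..L ^ Suc j}"
      have "real (card {d. d dvd n}) \<le> Cd * real n powr (\<delta> / real j)"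
        using n by (intro Cd) auto
      also have "\<dots> \<le> D"
      proof -
        have "n \<le> L ^ k"
          using n by (simp add: k)
        then have "real n \<le> real L ^ k"
          by (metis of_nat_le_iff of_nat_power)
        then show ?thesis
          unfolding D_def using Cd \<delta>j by (intro mult_left_mono powr_mono2) auto
      qed
      finally show "real (card {d. d dvd n}) \<le> D" .
    qed (use m0 R0 L1 in auto)
    \<comment> \<open>Since \<open>L = 2 ^ j * p\<close> and \<open>m = p ^ k\<close>, the values
      counted run over a number of periods modulo \<open>m\<close> that depends only on
      \<open>k\<close>.\<close>
    also have "2 ^ j * fact (j + 1) * real L ^ Suc j / real_of_int m = 2 ^ j * fact k * 2 ^ (j * k)"
    proof -
      have "real L ^ k = 2 ^ (j * k) * real_of_int m"
        by (simp add: L_def m_def power_mult_distrib power_mult)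
      moreover have "fact (j + 1) = (fact k :: real)"
        by (simp add: k)
      ultimately show ?thesis
        unfolding k[symmetric] using m0 by simp
    qed
    also have "(2 * (2 ^ j * fact k * 2 ^ (j * k)) + 2) = E"
      by (simp add: E_def)
    also have "(2 * D) ^ j = (2 * Cd) ^ j * (real L ^ k) powr \<delta>"
      using j0 L1 by (simp add: D_def power_mult_distrib powr_power)
    also have "(2 * Cd) ^ j * (real L ^ k) powr \<delta> * ((2 * (2 ^ j * R) + 1) * E) \<le>
        G * real N powr \<delta> * (F * (real p ^ (2 * k) / real N + 1) * E)"
    proof (rule mult_mono[OF _ mult_right_mono])
      have "(real L ^ k) powr \<delta> = (2 ^ (j * k)) powr \<delta> * (real p ^ k) powr \<delta>"
        by (simp add: L_def power_mult_distrib power_mult powr_mult)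
      also have "\<dots> \<le> (2 ^ (j * k)) powr \<delta> * real N powr \<delta>"
      proof (intro mult_left_mono powr_mono2)
        have "p ^ k \<le> N"
          using QN power_mono[OF p1(2)] by (meson le_trans zero_le)
        then show "real p ^ k \<le> real N"
          by (metis of_nat_le_iff of_nat_power)
      qed (use assms in auto)
      finally have "(2 * Cd) ^ j * (real L ^ k) powr \<delta> \<le> (2 * Cd) ^ j * ((2 ^ (j * k)) powr \<delta> * real N powr \<delta>)"
        using Cd by (intro mult_left_mono) auto
      then show "(2 * Cd) ^ j * (real L ^ k) powr \<delta> \<le> G * real N powr \<delta>"
        by (simp add: G_def mult.assoc)
      have "2 * (2 ^ j * R) = F * (real p ^ (2 * k) / real N)"
        by (simp add: F_def R_def)
      then show "2 * (2 ^ j * R) + 1 \<le> F * (real p ^ (2 * k) / real N + 1)"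
        using F1 by (simp add: distrib_left)
    qed (use G0 E0 R0 in auto)
    finally have "real (card (cubes j L m R (int b'))) \<le>
      real j * W ^ j + G * real N powr \<delta> * (F * (real p ^ (2 * k) / real N + 1) * E)"
      by (simp add: W_def)
    then have "real (card X) ^ \<kappa> \<le> W ^ (\<kappa> - k) *
        (real j * W ^ j + G * real N powr \<delta> * (F * (real p ^ (2 * k) / real N + 1) * E))"
      using 1 W1 by (smt (verit) mult_left_mono zero_le_power)
    also have "\<dots> = real j * W ^ (\<kappa> - 1) +
        G * E * F * real N powr \<delta> * (W ^ (\<kappa> - k) * (real p ^ (2 * k) / real N + 1))"
    proof -
      have "W ^ (\<kappa> - 1) = W ^ (\<kappa> - k) * W ^ j"
        using k\<kappa> by (simp add: power_add[symmetric] k)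
      then show ?thesis
        by (simp only: distrib_left mult_ac)
    qed
    also have "\<dots> \<le> real j * (w ^ \<kappa> * real N powr \<delta> * real Q ^ (\<kappa> - 1)) +
        G * E * F * real N powr \<delta> * (w ^ \<kappa> * (real Q ^ (\<kappa> - 1) + real Q ^ (\<kappa> + k) / real N))"
    proof -
      have WwQ: "W ^ i \<le> w ^ \<kappa> * real p ^ i" if "i \<le> \<kappa>" for i
      proof -
        have "1 * 1 \<le> (2::real) ^ j * real p"
          using p1 by (intro mult_mono) auto
        moreover have "W = 2 * (2 ^ j * real p) + 1" "w * real p = 3 * (2 ^ j * real p)"
          by (simp_all add: W_def w_def L_def)
        ultimately have "W \<le> w * real p"
          by linarith
        then have "W ^ i \<le> (w * real p) ^ i"
          using W1 by (intro power_mono) auto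
        also have "\<dots> \<le> w ^ \<kappa> * real p ^ i"
          unfolding power_mult_distrib using w1 that by (intro mult_right_mono power_increasing) auto
        finally show ?thesis .
      qed
      have "W ^ (\<kappa> - 1) \<le> w ^ \<kappa> * real p ^ (\<kappa> - 1)"
        by (rule WwQ) simp
      also have "\<dots> \<le> w ^ \<kappa> * real Q ^ (\<kappa> - 1)"
        using p1 w1 by (intro mult_left_mono power_mono) auto
      also have "\<dots> \<le> w ^ \<kappa> * real N powr \<delta> * real Q ^ (\<kappa> - 1)"
        using N\<delta> w1 by (intro mult_right_mono) auto
      finally have a: "W ^ (\<kappa> - 1) \<le> w ^ \<kappa> * real N powr \<delta> * real Q ^ (\<kappa> - 1)" .
      have "W ^ (\<kappa> - k) * (real p ^ (2 * k) / real N + 1) \<le>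
          w ^ \<kappa> * real p ^ (\<kappa> - k) * (real p ^ (2 * k) / real N + 1)"
        by (intro mult_right_mono WwQ) auto
      also have "\<dots> = w ^ \<kappa> * (real p ^ (\<kappa> - k) * real p ^ (2 * k) / real N + real p ^ (\<kappa> - k))"
        by (simp add: algebra_simps)
      also have "real p ^ (\<kappa> - k) * real p ^ (2 * k) = real p ^ (\<kappa> + k)"
        using k\<kappa> by (simp add: power_add[symmetric] add.commute)
      also have "w ^ \<kappa> * (real p ^ (\<kappa> + k) / real N + real p ^ (\<kappa> - k)) \<le>
          w ^ \<kappa> * (real Q ^ (\<kappa> + k) / real N + real Q ^ (\<kappa> - 1))"
      proof (intro mult_left_mono add_mono divide_right_mono power_mono)
        \<comment> \<open>The contribution that survives when \<open>R\<close> is small has the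
          lower exponent \<open>\<kappa> - k\<close> and is absorbed by the cubes with a zero
          side.\<close>
        have "real p ^ (\<kappa> - k) \<le> real p ^ (\<kappa> - 1)"
          using p1 by (intro power_increasing) (auto simp: k)
        also have "\<dots> \<le> real Q ^ (\<kappa> - 1)"
          using p1 by (intro power_mono) auto
        finally show "real p ^ (\<kappa> - k) \<le> real Q ^ (\<kappa> - 1)" .
      qed (use p1 w1 in auto)
      finally have b: "W ^ (\<kappa> - k) * (real p ^ (2 * k) / real N + 1) \<le>
          w ^ \<kappa> * (real Q ^ (\<kappa> - 1) + real Q ^ (\<kappa> + k) / real N)"
        by (simp only: add.commute)
      show ?thesis
        using a b G0 E0 F1 by (intro add_mono mult_left_mono) auto
    qed
    also have "\<dots> \<le> real j * (w ^ \<kappa> * real N powr \<delta> * (real Q ^ (\<kappa> - 1) + real Q ^ (\<kappa> + k) / real N)) +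
        G * E * F * real N powr \<delta> * (w ^ \<kappa> * (real Q ^ (\<kappa> - 1) + real Q ^ (\<kappa> + k) / real N))"
      using w1 G0 E0 F1 by (intro add_mono mult_left_mono) auto
    also have "\<dots> = C * real N powr \<delta> * (real Q ^ (\<kappa> - 1) + real Q ^ (\<kappa> + k) / real N)"
      by (simp only: C_def distrib_left distrib_right mult_ac)
    finally show ?thesis .
  qed
  show ?thesis
    using that[OF C0] main by blast
qed

section \<open>The large sieve for clustered points\<close>

text \<open>By \<open>2 * x * y \<le> x\<^sup>2 + y\<^sup>2\<close> the form is bounded by two half
  sums, which coincide because the absolute values of \<open>H\<close> are symmetric; each is then a
  weighted sum of row sums.\<close>

lemma schur_test:
  fixes H :: "'a \<Rightarrow> 'a \<Rightarrow> complex" and c :: "'a \<Rightarrow> complex"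
  assumes sym: "\<And>s t. cmod (H s t) = cmod (H t s)"
    and D: "\<And>s. s \<in> A \<Longrightarrow> (\<Sum>t\<in>A. cmod (H s t)) \<le> D"
  shows "cmod (\<Sum>s\<in>A. \<Sum>t\<in>A. c s * cnj (c t) * H s t) \<le> D * (\<Sum>s\<in>A. (cmod (c s))\<^sup>2)"
proof -
  have "cmod (\<Sum>s\<in>A. \<Sum>t\<in>A. c s * cnj (c t) * H s t) \<le> (\<Sum>s\<in>A. \<Sum>t\<in>A. cmod (c s * cnj (c t) * H s t))"
    by (intro order_trans[OF norm_sum] sum_mono norm_sum)
  also have "\<dots> \<le> (\<Sum>s\<in>A. \<Sum>t\<in>A. ((cmod (c s))\<^sup>2 / 2 + (cmod (c t))\<^sup>2 / 2) * cmod (H s t))"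
  proof (intro sum_mono)
    fix s t
    have "cmod (c s) * cmod (c t) \<le> (cmod (c s))\<^sup>2 / 2 + (cmod (c t))\<^sup>2 / 2"
      using sum_squares_bound[of "cmod (c s)" "cmod (c t)"] by simp
    then show "cmod (c s * cnj (c t) * H s t) \<le> ((cmod (c s))\<^sup>2 / 2 + (cmod (c t))\<^sup>2 / 2) * cmod (H s t)"
      by (simp add: norm_mult mult_right_mono)
  qed
  also have "\<dots> = (\<Sum>s\<in>A. \<Sum>t\<in>A. (cmod (c s))\<^sup>2 / 2 * cmod (H s t)) +
                   (\<Sum>s\<in>A. \<Sum>t\<in>A. (cmod (c t))\<^sup>2 / 2 * cmod (H s t))"
    by (simp add: distrib_right sum.distrib)
  also have "(\<Sum>s\<in>A. \<Sum>t\<in>A. (cmod (c t))\<^sup>2 / 2 * cmod (H s t)) =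
             (\<Sum>s\<in>A. \<Sum>t\<in>A. (cmod (c s))\<^sup>2 / 2 * cmod (H s t))"
    by (subst sum.swap) (simp only: sym)
  also have "(\<Sum>s\<in>A. \<Sum>t\<in>A. (cmod (c s))\<^sup>2 / 2 * cmod (H s t)) =
             (\<Sum>s\<in>A. (cmod (c s))\<^sup>2 / 2 * (\<Sum>t\<in>A. cmod (H s t)))"
    by (simp add: sum_distrib_left)
  also have "\<dots> \<le> (\<Sum>s\<in>A. (cmod (c s))\<^sup>2 / 2 * D)"
    by (intro sum_mono mult_left_mono D) auto
  also have "\<dots> = D / 2 * (\<Sum>s\<in>A. (cmod (c s))\<^sup>2)"
    by (simp add: sum_distrib_left mult_ac)
  finally show ?thesis by simp
qed

text \<open>Expanding the squares gives the quadratic form of the Gram matrix of the columns of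
  \<open>\<phi>\<close>, which is Hermitian, so the Schur test applies.\<close>

lemma sum_sq_le_columns:
  fixes a :: "'n \<Rightarrow> complex" and \<phi> :: "'r \<Rightarrow> 'n \<Rightarrow> complex"
  assumes "\<And>n. n \<in> I \<Longrightarrow> (\<Sum>m\<in>I. cmod (\<Sum>r\<in>X. \<phi> r n * cnj (\<phi> r m))) \<le> D"
  shows "(\<Sum>r\<in>X. (cmod (\<Sum>n\<in>I. a n * \<phi> r n))\<^sup>2) \<le> D * (\<Sum>n\<in>I. (cmod (a n))\<^sup>2)"
proof -
  define H where "H n m = (\<Sum>r\<in>X. \<phi> r n * cnj (\<phi> r m))" for n m
  have sym: "cmod (H n m) = cmod (H m n)" for n m
  proof -
    have "H n m = cnj (H m n)"
      by (simp add: H_def mult.commute)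
    then show ?thesis by simp
  qed
  have "complex_of_real (\<Sum>r\<in>X. (cmod (\<Sum>n\<in>I. a n * \<phi> r n))\<^sup>2) =
      (\<Sum>r\<in>X. (\<Sum>n\<in>I. a n * \<phi> r n) * cnj (\<Sum>m\<in>I. a m * \<phi> r m))"
    by (simp only: of_real_sum complex_norm_square)
  also have "\<dots> = (\<Sum>r\<in>X. \<Sum>n\<in>I. \<Sum>m\<in>I. a n * cnj (a m) * (\<phi> r n * cnj (\<phi> r m)))"
    by (simp add: sum_product mult_ac)
  also have "\<dots> = (\<Sum>n\<in>I. \<Sum>r\<in>X. \<Sum>m\<in>I. a n * cnj (a m) * (\<phi> r n * cnj (\<phi> r m)))"
    by (rule sum.swap)
  also have "\<dots> = (\<Sum>n\<in>I. \<Sum>m\<in>I. \<Sum>r\<in>X. a n * cnj (a m) * (\<phi> r n * cnj (\<phi> r m)))"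
    by (intro sum.cong refl sum.swap)
  also have "\<dots> = (\<Sum>n\<in>I. \<Sum>m\<in>I. a n * cnj (a m) * H n m)"
    by (simp add: H_def sum_distrib_left)
  finally have "(\<Sum>r\<in>X. (cmod (\<Sum>n\<in>I. a n * \<phi> r n))\<^sup>2) = Re (\<Sum>n\<in>I. \<Sum>m\<in>I. a n * cnj (a m) * H n m)"
    by (metis Re_complex_of_real)
  also have "\<dots> \<le> cmod (\<Sum>n\<in>I. \<Sum>m\<in>I. a n * cnj (a m) * H n m)"
    by (rule complex_Re_le_cmod)
  also have "\<dots> \<le> D * (\<Sum>n\<in>I. (cmod (a n))\<^sup>2)"
    using assms by (intro schur_test sym) (auto simp: H_def)
  finally show ?thesis .
qed

text \<open>Duality: the left side \<open>U\<close> equals the pairing of \<open>a\<close> with a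
  combination \<open>b\<close> of the rows weighted by \<open>cnj (S r)\<close>. Cauchy-Schwarz and
  the column bound for the transposed matrix give \<open>U\<^sup>2 \<le> D * E * U\<close>, and
  \<open>U\<close> cancels.\<close>

lemma sum_sq_le_rows:
  fixes a :: "'n \<Rightarrow> complex" and \<phi> :: "'r \<Rightarrow> 'n \<Rightarrow> complex"
  assumes "\<And>r. r \<in> X \<Longrightarrow> (\<Sum>s\<in>X. cmod (\<Sum>n\<in>I. \<phi> r n * cnj (\<phi> s n))) \<le> D" "D \<ge> 0"
  shows "(\<Sum>r\<in>X. (cmod (\<Sum>n\<in>I. a n * \<phi> r n))\<^sup>2) \<le> D * (\<Sum>n\<in>I. (cmod (a n))\<^sup>2)"
proof -
  define S where "S r = (\<Sum>n\<in>I. a n * \<phi> r n)" for r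
  define b where "b n = (\<Sum>r\<in>X. cnj (S r) * \<phi> r n)" for n
  define U where "U = (\<Sum>r\<in>X. (cmod (S r))\<^sup>2)"
  define E where "E = (\<Sum>n\<in>I. (cmod (a n))\<^sup>2)"
  have U0: "U \<ge> 0" and E0: "E \<ge> 0"
    by (simp_all add: U_def E_def sum_nonneg)
  have "complex_of_real U = (\<Sum>r\<in>X. (\<Sum>n\<in>I. a n * \<phi> r n) * cnj (S r))"
    unfolding U_def of_real_sum complex_norm_square by (simp add: S_def)
  also have "\<dots> = (\<Sum>r\<in>X. \<Sum>n\<in>I. a n * (cnj (S r) * \<phi> r n))"
    by (intro sum.cong refl) (simp add: sum_distrib_left sum_distrib_right mult_ac)
  also have "\<dots> = (\<Sum>n\<in>I. a n * b n)"
    by (subst sum.swap) (simp add: b_def sum_distrib_left)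
  finally have "U \<le> cmod (\<Sum>n\<in>I. a n * b n)"
    by (metis complex_Re_le_cmod Re_complex_of_real)
  also have "\<dots> \<le> (\<Sum>n\<in>I. cmod (a n) * cmod (b n))"
    by (rule order_trans[OF norm_sum]) (simp add: norm_mult)
  finally have "U\<^sup>2 \<le> (\<Sum>n\<in>I. cmod (a n) * cmod (b n))\<^sup>2"
    using U0 by (intro power_mono)
  also have "\<dots> \<le> E * (\<Sum>n\<in>I. (cmod (b n))\<^sup>2)"
    unfolding E_def by (rule Cauchy_Schwarz_ineq_sum)
  also have "(\<Sum>n\<in>I. (cmod (b n))\<^sup>2) \<le> D * (\<Sum>r\<in>X. (cmod (cnj (S r)))\<^sup>2)"
    unfolding b_def by (rule sum_sq_le_columns[where \<phi> = "\<lambda>n r. \<phi> r n"]) (rule assms(1))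
  then have "E * (\<Sum>n\<in>I. (cmod (b n))\<^sup>2) \<le> E * (D * U)"
    using E0 by (intro mult_left_mono) (auto simp: U_def)
  finally have "U * U \<le> (D * E) * U"
    by (simp add: power2_eq_square mult_ac)
  then have "U \<le> D * E"
    using U0 E0 assms(2) by (cases "U = 0") (auto simp: mult_le_cancel_right)
  then show ?thesis
    by (simp add: U_def E_def S_def)
qed

section \<open>Geometric sums and the clustered large sieve\<close>

text \<open>On \<open>0 \<le> x \<le> 8 / 5\<close> the cubic Taylor error is at most
  \<open>x / 2\<close>, so \<open>sin x \<ge> x / 2\<close>, and
  \<open>x = pi * \<bar>t\<bar>\<close> is at least \<open>2 * \<bar>t\<bar>\<close>.\<close>

lemma abs_sin_pi_ge:
  fixes t :: real
  assumes "\<bar>t\<bar> \<le> 1 / 2"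
  shows "\<bar>t\<bar> \<le> \<bar>sin (pi * t)\<bar>"
proof -
  define x where "x = pi * \<bar>t\<bar>"
  have x0: "x \<ge> 0"
    by (simp add: x_def)
  have "x \<le> pi * (1 / 2)"
    unfolding x_def using assms by (intro mult_left_mono) auto
  moreover have "pi \<le> 16 / 5"
    by (rule order_trans[OF pi_approx(2)]) simp
  ultimately have "x \<le> 8 / 5"
    by linarith
  then have "x\<^sup>2 \<le> (8 / 5)\<^sup>2"
    using x0 by (intro power_mono)
  then have "x\<^sup>2 / 6 \<le> 1 / 2"
    by (simp add: power2_eq_square)
  then have "x * (x\<^sup>2 / 6) \<le> x * (1 / 2)"
    using x0 by (intro mult_left_mono)
  moreover have "\<bar>sin x - x\<bar> \<le> x * (x\<^sup>2 / 6)"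
    using Maclaurin_sin_bound[of x 3] x0
    by (simp add: sin_coeff_def numeral_3_eq_3 lessThan_Suc power2_eq_square fact_numeral)
  ultimately have "x / 2 \<le> sin x"
    by linarith
  moreover have "2 * \<bar>t\<bar> \<le> x"
    unfolding x_def using pi_ge_two by (intro mult_right_mono) auto
  moreover have "\<bar>sin (pi * t)\<bar> = \<bar>sin x\<bar>"
    by (simp add: x_def abs_if)
  ultimately show ?thesis by linarith
qed

text \<open>The summed series has numerator at most 2 and denominator
  \<open>2 * \<bar>sin (pi * t)\<bar> \<ge> 2 * \<bar>t\<bar>\<close>. The product form also covers
  \<open>t = 0\<close>.\<close>

lemma norm_geometric_le:
  fixes \<theta> t :: real and z :: int
  assumes "\<theta> = t + of_int z" "\<bar>t\<bar> \<le> 1 / 2"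
  shows "cmod (\<Sum>n = M + 1..M + N. cis (2 * pi * (\<theta> * real n))) * \<bar>t\<bar> \<le> 1"
proof (cases "N = 0")
  case True
  then show ?thesis by simp
next
  case False
  define w where "w = cis (2 * pi * \<theta>)"
  have w: "w = cis (2 * pi * t)"
    unfolding w_def assms(1) by (simp add: distrib_left cis_mult[symmetric])
  have "cmod (w - 1) = 2 * \<bar>sin (pi * t)\<bar>"
    using dist_exp_i_1[of "2 * pi * t"] by (simp add: w cis_conv_exp)
  then have 1: "2 * \<bar>t\<bar> \<le> cmod (1 - w)"
    using abs_sin_pi_ge[OF assms(2)] by (simp add: norm_minus_commute)
  have pw: "cis (2 * pi * (\<theta> * real n)) = w ^ n" for n
    by (simp add: w_def Complex.DeMoivre mult_ac)
  have "cmod (1 - w) * cmod (\<Sum>n = M + 1..M + N. w ^ n) = cmod (w ^ (M + 1) - w ^ Suc (M + N))"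
    using False by (subst norm_mult[symmetric], subst sum_gp_multiplied) auto
  also have "\<dots> \<le> cmod (w ^ (M + 1)) + cmod (w ^ Suc (M + N))"
    by (rule norm_triangle_ineq4)
  also have "\<dots> = 2"
    by (simp only: norm_power) (simp add: w)
  finally have "cmod (1 - w) * cmod (\<Sum>n = M + 1..M + N. w ^ n) \<le> 2" .
  then have "2 * \<bar>t\<bar> * cmod (\<Sum>n = M + 1..M + N. w ^ n) \<le> 2"
    using mult_right_mono[OF 1, of "cmod (\<Sum>n = M + 1..M + N. w ^ n)"] by simp
  then show ?thesis
    unfolding pw by (simp add: mult_ac)
qed

text \<open>For a fixed point, the others are sorted into shells by the integer part of
  \<open>N\<close> times their distance modulo 1. The two sides of a shell are clusters of at most
  \<open>K\<close> points, the kernel on shell \<open>i\<close> is at most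
  \<open>2 * N / (i + 1)\<close>, and summing over shells gives the harmonic number.\<close>

lemma large_sieve_clusters:
  fixes \<alpha> :: "'r \<Rightarrow> real" and a :: "nat \<Rightarrow> complex"
  assumes "finite X" "N \<ge> 1" "K \<ge> 0"
    and K: "\<And>Y. Y \<subseteq> X \<Longrightarrow>
      (\<And>s s'. s \<in> Y \<Longrightarrow> s' \<in> Y \<Longrightarrow> \<exists>z::int. \<bar>\<alpha> s - \<alpha> s' - z\<bar> < 1 / real N) \<Longrightarrow> real (card Y) \<le> K"
  shows "(\<Sum>r\<in>X. (cmod (\<Sum>n = M + 1..M + N. a n * cis (2 * pi * (\<alpha> r * real n))))\<^sup>2) \<le>
    4 * K * real N * harm (N + 1) * (\<Sum>n = M + 1..M + N. (cmod (a n))\<^sup>2)"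
proof (rule sum_sq_le_rows)
  show "4 * K * real N * harm (N + 1) \<ge> 0"
    using assms by (simp add: harm_nonneg)
  fix r
  define G where "G s = cmod (\<Sum>n = M + 1..M + N. cis (2 * pi * (\<alpha> r * real n)) * cnj (cis (2 * pi * (\<alpha> s * real n))))" for s
  define z where "z s = round (\<alpha> r - \<alpha> s)" for s
  define t where "t s = \<alpha> r - \<alpha> s - of_int (z s)" for s
  define i where "i s = nat \<lfloor>real N * \<bar>t s\<bar>\<rfloor>" for s
  have N0: "real N > 0"
    using assms by simp
  have t: "\<bar>t s\<bar> \<le> 1 / 2" for s
    using of_int_round_abs_le[of "\<alpha> r - \<alpha> s"] by (simp add: t_def z_def abs_minus_commute)
  have i: "real (i s) \<le> real N * \<bar>t s\<bar>" "real N * \<bar>t s\<bar> < real (i s) + 1" for s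
  proof -
    have "\<lfloor>real N * \<bar>t s\<bar>\<rfloor> \<ge> 0"
      by simp
    then have "real (i s) = of_int \<lfloor>real N * \<bar>t s\<bar>\<rfloor>"
      by (simp add: i_def)
    then show "real (i s) \<le> real N * \<bar>t s\<bar>" "real N * \<bar>t s\<bar> < real (i s) + 1"
      by linarith+
  qed
  have iN: "i s \<le> N" for s
  proof -
    have "real N * \<bar>t s\<bar> \<le> real N * 1"
      using t[of s] N0 by (intro mult_left_mono) auto
    then have "real (i s) \<le> real N"
      using i[of s] by linarith
    then show ?thesis by simp
  qed
  have Gt: "G s * \<bar>t s\<bar> \<le> 1" for s
  proof -
    have "G s = cmod (\<Sum>n = M + 1..M + N. cis (2 * pi * ((\<alpha> r - \<alpha> s) * real n)))"
      by (simp add: G_def cis_cnj cis_mult algebra_simps)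
    then show ?thesis
      using norm_geometric_le[of "\<alpha> r - \<alpha> s" "t s" "z s" M N] t[of s] by (simp add: t_def)
  qed
  have GN: "G s \<le> real N" for s
  proof -
    have "G s \<le> (\<Sum>n = M + 1..M + N. 1)"
      unfolding G_def by (rule order_trans[OF norm_sum]) (simp add: norm_mult)
    then show ?thesis by simp
  qed
  \<comment> \<open>The trivial bound \<open>N\<close> serves shell 0; on later shells the geometric
    bound gives \<open>G s * i s \<le> N\<close>, and \<open>G s \<le> G s * i s\<close> pays for
    replacing \<open>i s\<close> by \<open>i s + 1\<close>.\<close>
  have G: "G s \<le> 2 * real N / (real (i s) + 1)" for s
  proof (cases "i s = 0")
    case True
    then show ?thesis
      using GN[of s] by simp
  next
    case False
    have "G s * real (i s) \<le> G s * (real N * \<bar>t s\<bar>)"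
      using i by (intro mult_left_mono) (auto simp: G_def)
    also have "\<dots> = real N * (G s * \<bar>t s\<bar>)"
      by simp
    also have "\<dots> \<le> real N * 1"
      by (intro mult_left_mono Gt) simp
    finally have "G s * real (i s) \<le> real N"
      by simp
    moreover have "G s * 1 \<le> G s * real (i s)"
      using False by (intro mult_left_mono) (auto simp: G_def)
    ultimately have "G s * (real (i s) + 1) \<le> 2 * real N"
      by (simp add: distrib_left)
    then show ?thesis
      by (simp add: pos_le_divide_eq)
  qed
  have cardi: "real (card {s \<in> X. i s = l}) \<le> 2 * K" for l
  proof -
    \<comment> \<open>Splitting by the sign of \<open>t\<close> is what makes equal shells close:
      points on opposite sides can be nearly \<open>2 * (l + 1) / N\<close> apart.\<close>
    define Y where "Y \<sigma> = {s \<in> X. i s = l \<and> (t s \<ge> 0 \<longleftrightarrow> \<sigma>)}" for \<sigma>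
    have Y: "real (card (Y \<sigma>)) \<le> K" for \<sigma>
    proof (rule K)
      fix s s' assume s: "s \<in> Y \<sigma>" and s': "s' \<in> Y \<sigma>"
      have "real N * \<bar>t s - t s'\<bar> < 1"
      proof -
        have "\<bar>t s - t s'\<bar> = \<bar>\<bar>t s\<bar> - \<bar>t s'\<bar>\<bar>"
          using s s' by (cases \<sigma>) (auto simp: Y_def)
        then have "real N * \<bar>t s - t s'\<bar> = \<bar>real N * \<bar>t s\<bar> - real N * \<bar>t s'\<bar>\<bar>"
          by (simp add: right_diff_distrib[symmetric] abs_mult)
        also have "\<dots> < 1"
          using i[of s] i[of s'] s s' by (auto simp: Y_def)
        finally show ?thesis .
      qed
      then have "\<bar>\<alpha> s - \<alpha> s' - of_int (z s' - z s)\<bar> < 1 / real N"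
        using N0 by (simp add: t_def pos_less_divide_eq mult_ac abs_minus_commute algebra_simps)
      then show "\<exists>z::int. \<bar>\<alpha> s - \<alpha> s' - z\<bar> < 1 / real N" by blast
    qed (auto simp: Y_def)
    have "{s \<in> X. i s = l} = Y True \<union> Y False"
      by (auto simp: Y_def)
    then have "card {s \<in> X. i s = l} \<le> card (Y True) + card (Y False)"
      by (simp add: card_Un_le)
    then have "real (card {s \<in> X. i s = l}) \<le> real (card (Y True)) + real (card (Y False))"
      by linarith
    then show ?thesis
      using Y[of True] Y[of False] by linarith
  qed
  have "(\<Sum>s\<in>X. G s) \<le> (\<Sum>s\<in>X. 2 * real N / (real (i s) + 1))"
    by (intro sum_mono G)
  also have "\<dots> = (\<Sum>l\<le>N. \<Sum>s\<in>{s \<in> X. i s = l}. 2 * real N / (real (i s) + 1))"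
    using assms(1) iN by (intro sum.group[symmetric]) auto
  also have "\<dots> = (\<Sum>l\<le>N. real (card {s \<in> X. i s = l}) * (2 * real N / (real l + 1)))"
    by (intro sum.cong refl) simp
  also have "\<dots> \<le> (\<Sum>l\<le>N. (2 * K) * (2 * real N / (real l + 1)))"
    by (intro sum_mono mult_right_mono cardi) auto
  also have "\<dots> = 4 * K * real N * (\<Sum>l\<le>N. inverse (real (Suc l)))"
    by (simp add: sum_distrib_left field_simps)
  also have "(\<Sum>l\<le>N. inverse (real (Suc l))) = harm (N + 1)"
    unfolding harm_def by (simp add: sum.atLeast1_atMost_eq flip: lessThan_Suc_atMost)
  finally show "(\<Sum>s\<in>X. cmod (\<Sum>n = M + 1..M + N. cis (2 * pi * (\<alpha> r * real n)) *
      cnj (cis (2 * pi * (\<alpha> s * real n))))) \<le> 4 * K * real N * harm (N + 1)"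
    by (simp add: G_def)
qed

section \<open>Complete sums over residues\<close>

text \<open>Orthogonality makes the Gram entry of columns \<open>n\<close> and \<open>l\<close>
  vanish unless \<open>n\<close> and \<open>l\<close> are congruent modulo \<open>m\<close>. At most
  \<open>N / m + 2\<close> indices \<open>l\<close> remain, each contributing at most
  \<open>m\<close>.\<close>

lemma sum_roots_of_unity_le:
  fixes a :: "nat \<Rightarrow> complex"
  assumes "m > 0" "N \<ge> 1"
  shows "(\<Sum>b = 1..m. (cmod (\<Sum>n = M + 1..M + N. a n * cis (2 * pi * (real b / real m * real n))))\<^sup>2) \<le>
    (real N + 2 * real m) * (\<Sum>n = M + 1..M + N. (cmod (a n))\<^sup>2)"
proof (rule sum_sq_le_columns)
  fix n
  define I where "I = {M + 1..M + N}"
  define G where "G l = cmod (\<Sum>b = 1..m. cis (2 * pi * (real b / real m * real n)) *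
      cnj (cis (2 * pi * (real b / real m * real l))))" for l
  define J where "J = {l \<in> I. int m dvd int n - int l}"
  \<comment> \<open>The summands are the powers of an \<open>m\<close>-th root of unity different
    from 1, and these cancel over a full period.\<close>
  have G0: "G l = 0" if "\<not> int m dvd int n - int l" for l
  proof -
    define w where "w = cis (2 * pi * ((real n - real l) / real m))"
    have cancel: "u = v" if "2 * pi * u = v * (2 * pi)" for u v :: real
      using that by simp
    have "w \<noteq> 1"
    proof
      assume "w = 1"
      then obtain z :: int where "2 * pi * ((real n - real l) / real m) = of_int z * (2 * pi)"
        unfolding w_def cis_eq_1_iff by blast
      then have "(real n - real l) / real m = of_int z"
        by (rule cancel)
      then have "real n - real l = of_int z * real m"
        using assms by (simp add: field_simps)
      then have "real_of_int (int n - int l) = real_of_int (z * int m)"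
        by simp
      then have "int n - int l = z * int m"
        by (simp only: of_int_eq_iff)
      then show False
        using that by simp
    qed
    have "real m * (2 * pi * ((real n - real l) / real m)) = 2 * pi * of_int (int n - int l)"
      using assms by simp
    then have "w ^ m = cis (2 * pi * of_int (int n - int l))"
      by (simp only: w_def Complex.DeMoivre)
    then have "w ^ m = 1"
      by simp
    then have "(1 - w) * (\<Sum>b = 1..m. w ^ b) = 0"
      using assms by (subst sum_gp_multiplied) auto
    then have "(\<Sum>b = 1..m. w ^ b) = 0"
      using \<open>w \<noteq> 1\<close> by simp
    moreover have "cis (2 * pi * (real b / real m * real n)) * cnj (cis (2 * pi * (real b / real m * real l))) = w ^ b" for b
      by (simp add: w_def cis_cnj cis_mult Complex.DeMoivre algebra_simps diff_divide_distrib)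
    ultimately show ?thesis
      by (simp add: G_def)
  qed
  have Gm: "G l \<le> real m" for l
  proof -
    have "G l \<le> (\<Sum>b = 1..m. 1)"
      unfolding G_def by (rule order_trans[OF norm_sum]) (simp add: norm_mult)
    then show ?thesis by simp
  qed
  have "(\<Sum>l\<in>I. G l) = (\<Sum>l\<in>J. G l)"
    by (rule sum.mono_neutral_right) (auto simp: J_def I_def G0)
  also have "\<dots> \<le> real (card J) * real m"
    by (rule sum_bounded_above) (rule Gm)
  also have "real (card J) \<le> real N / real m + 2"
  proof -
    have "real (card (int ` J)) \<le> (real_of_int (int (M + N)) - real_of_int (int M)) / real_of_int (int m) + 2"
    proof (rule card_congruent_le)
      fix x y assume "x \<in> int ` J" "y \<in> int ` J"
      then have "int m dvd int n - y" "int m dvd int n - x"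
        by (auto simp: J_def)
      then have "int m dvd (int n - y) - (int n - x)"
        by (rule dvd_diff)
      then show "int m dvd x - y" by simp
    qed (use assms in \<open>auto simp: J_def I_def\<close>)
    then show ?thesis
      by (simp add: card_image)
  qed
  then have "real (card J) * real m \<le> (real N / real m + 2) * real m"
    by (intro mult_right_mono) auto
  also have "\<dots> = real N + 2 * real m"
    using assms by (simp add: field_simps)
  finally show "(\<Sum>l = M + 1..M + N. cmod (\<Sum>b = 1..m. cis (2 * pi * (real b / real m * real n)) *
      cnj (cis (2 * pi * (real b / real m * real l))))) \<le> real N + 2 * real m"
    by (simp add: G_def I_def)
qed

section \<open>Assembly of the final estimate\<close>

lemma harm_le_powr:
  assumes "\<eta> > 0" "N \<ge> 1"
  shows "harm (N + 1) \<le> (1 + 2 powr \<eta> / \<eta>) * real N powr \<eta>"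
proof -
  have "harm (Suc N) - ln (real (Suc N)) \<le> harm (Suc 0) - ln (real (Suc 0))"
    using decseqD[OF decseq_harm_diff_ln, of 0 N] by simp
  then have "harm (N + 1) \<le> 1 + ln (real N + 1)"
    by (simp add: harm_def add.commute)
  also have "ln (real N + 1) \<le> ln (2 * real N)"
    using assms by simp
  also have "\<dots> \<le> (2 * real N) powr \<eta> / \<eta>"
    using assms by (intro ln_powr_bound) auto
  also have "1 + (2 * real N) powr \<eta> / \<eta> \<le> real N powr \<eta> + (2 * real N) powr \<eta> / \<eta>"
    using assms by (simp add: ge_one_powr_ge_zero)
  also have "\<dots> = (1 + 2 powr \<eta> / \<eta>) * real N powr \<eta>"
    using assms by (simp add: powr_mult field_simps)
  finally show ?thesis by simp
qed

lemma unit_exp_fraction: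
  "unit_exp (of_nat b / of_nat q ^ k * of_nat n) = cis (2 * pi * (real b / real q ^ k * real n))"
  by (simp add: unit_exp_def cis_conv_exp mult_ac)

theorem theorem3:
  fixes k \<kappa> :: nat and \<epsilon> :: real
  assumes "k \<ge> 2" and "\<kappa> = 2 ^ (k - 1)" and "\<epsilon> > 0"
  shows "\<exists>C::real. C > 0 \<and>
    (\<forall>(a :: nat \<Rightarrow> complex) (Q::nat) (M::nat) (N::nat).
      Q \<ge> 1 \<longrightarrow> M \<ge> 1 \<longrightarrow> N \<ge> 1 \<longrightarrow>
      (\<Sum>q = 1..Q. \<Sum>b \<in> coprime_residues k q.
         (cmod (\<Sum>n = M + 1..M + N. a n * unit_exp (of_nat b / of_nat q ^ k * of_nat n)))\<^sup>2)
      \<le> C * ln (2 * real Q) *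
         (real Q ^ (k + 1) +
          real N powr \<epsilon> *
            (real N * real Q powr ((real \<kappa> - 1) / real \<kappa>) +
             real N powr (1 - 1 / real \<kappa>) * real Q powr ((real \<kappa> + real k) / real \<kappa>))) *
         (\<Sum>n = M + 1..M + N. (cmod (a n))\<^sup>2))"
proof -
  \<comment> \<open>After the \<open>\<kappa>\<close>-th root the cluster bound costs
    \<open>N powr (\<epsilon> / 2)\<close>; the other half of \<open>\<epsilon>\<close> pays for the
    harmonic number.\<close>
  define \<delta> where "\<delta> = real \<kappa> * (\<epsilon> / 2)"
  define \<eta> where "\<eta> = \<epsilon> / 2"
  have \<kappa>0: "\<kappa> > 0"
    by (simp add: assms(2))
  have \<delta>: "\<delta> > 0" and \<eta>: "\<eta> > 0"
    using \<kappa>0 assms(3) by (simp_all add: \<delta>_def \<eta>_def)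
  obtain C1 where C1: "C1 > 0"
    and close: "\<And>(Q::nat) (N::nat) X. Q ^ k \<le> N \<Longrightarrow> X \<subseteq> Sigma {1..Q} (coprime_residues k) \<Longrightarrow>
      (\<And>q b q' b'. (q, b) \<in> X \<Longrightarrow> (q', b') \<in> X \<Longrightarrow>
        \<exists>z::int. \<bar>real b / real q ^ k - real b' / real q' ^ k - z\<bar> < 1 / real N) \<Longrightarrow>
      real (card X) ^ \<kappa> \<le> C1 * real N powr \<delta> * (real Q ^ (\<kappa> - 1) + real Q ^ (\<kappa> + k) / real N)"
    using card_close_fractions[OF assms(1) \<delta>, folded assms(2)] by metis
  define B where "B = C1 powr (1 / real \<kappa>)"
  define H where "H = 1 + 2 powr \<eta> / \<eta>"
  \<comment> \<open>The 3 comes from the range \<open>N \<le> Q ^ k\<close>, where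
    \<open>N + 2 * q ^ k \<le> 3 * Q ^ k\<close>; the rest comes from the large sieve in the
    complementary range.\<close>
  define C0 where "C0 = 3 + 4 * B * H"
  have B0: "B \<ge> 0" and H0: "H \<ge> 0"
    using \<eta> by (simp_all add: B_def H_def)
  have BH: "4 * B * H \<ge> 0"
    using B0 H0 by simp
  have bound: "(\<Sum>q = 1..Q. \<Sum>b \<in> coprime_residues k q.
         (cmod (\<Sum>n = M + 1..M + N. a n * unit_exp (of_nat b / of_nat q ^ k * of_nat n)))\<^sup>2)
      \<le> C0 / ln 2 * ln (2 * real Q) *
         (real Q ^ (k + 1) +
          real N powr \<epsilon> *
            (real N * real Q powr ((real \<kappa> - 1) / real \<kappa>) +
             real N powr (1 - 1 / real \<kappa>) * real Q powr ((real \<kappa> + real k) / real \<kappa>))) *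
         (\<Sum>n = M + 1..M + N. (cmod (a n))\<^sup>2)"
    if Q1: "Q \<ge> 1" and N1: "N \<ge> 1" for a :: "nat \<Rightarrow> complex" and Q M N :: nat
  proof -
    define E where "E = (\<Sum>n = M + 1..M + N. (cmod (a n))\<^sup>2)"
    define V where "V = real N * real Q powr ((real \<kappa> - 1) / real \<kappa>) +
             real N powr (1 - 1 / real \<kappa>) * real Q powr ((real \<kappa> + real k) / real \<kappa>)"
    define S where "S q b = (cmod (\<Sum>n = M + 1..M + N. a n * cis (2 * pi * (real b / real q ^ k * real n))))\<^sup>2" for q b
    define T where "T = (\<Sum>q = 1..Q. \<Sum>b \<in> coprime_residues k q. S q b)"
    have E0: "E \<ge> 0"
      by (simp add: E_def sum_nonneg)
    have V0: "V \<ge> 0"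
      by (simp add: V_def)
    have "T \<le> C0 * (real Q ^ (k + 1) + real N powr \<epsilon> * V) * E"
    proof (cases "N \<le> Q ^ k")
      case True
      have "(\<Sum>b \<in> coprime_residues k q. S q b) \<le> 3 * real Q ^ k * E" if "q \<in> {1..Q}" for q
      proof -
        \<comment> \<open>By positivity the sum may be completed to all residues modulo
          \<open>q ^ k\<close>.\<close>
        have "(\<Sum>b \<in> coprime_residues k q. S q b) \<le> (\<Sum>b = 1..q ^ k. S q b)"
          by (rule sum_mono2) (auto simp: coprime_residues_def S_def)
        also have "\<dots> \<le> (real N + 2 * real (q ^ k)) * E"
          using sum_roots_of_unity_le[of "q ^ k" N a M] that N1 by (simp add: S_def E_def)
        also have "\<dots> \<le> (3 * real Q ^ k) * E"
        proof (intro mult_right_mono E0)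
          have "real N \<le> real Q ^ k"
            using True by (metis of_nat_le_iff of_nat_power)
          moreover have "real q ^ k \<le> real Q ^ k"
            using that by (intro power_mono) auto
          ultimately show "real N + 2 * real (q ^ k) \<le> 3 * real Q ^ k"
            unfolding of_nat_power by linarith
        qed
        finally show ?thesis .
      qed
      then have "T \<le> (\<Sum>q = 1..Q. 3 * real Q ^ k * E)"
        unfolding T_def by (intro sum_mono)
      also have "\<dots> = 3 * real Q ^ (k + 1) * E"
        by simp
      also have "\<dots> \<le> C0 * (real Q ^ (k + 1) + real N powr \<epsilon> * V) * E"
        using BH V0 by (intro mult_right_mono mult_mono E0) (auto simp: C0_def)
      finally show ?thesis .
    next
      case False
      \<comment> \<open>This dominates the \<open>\<kappa>\<close>-th root of the cluster bound:
        \<open>V / N\<close> is the sum of the \<open>\<kappa>\<close>-th roots of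
        \<open>Q ^ (\<kappa> - 1)\<close> and \<open>Q ^ (\<kappa> + k) / N\<close>.\<close>
      define K where "K = B * real N powr \<eta> * (V / real N)"
      have N0: "real N > 0"
        using N1 by simp
      have K0: "K \<ge> 0"
        using B0 V0 by (simp add: K_def)
      have VN: "V / real N = real Q powr ((real \<kappa> - 1) / real \<kappa>) +
          real Q powr ((real \<kappa> + real k) / real \<kappa>) * real N powr - (1 / real \<kappa>)"
      proof -
        have "real N powr (1 - 1 / real \<kappa>) = real N * real N powr - (1 / real \<kappa>)"
          using N0 by (simp add: powr_diff powr_minus divide_inverse)
        then show ?thesis
          using N0 by (simp add: V_def add_divide_distrib)
      qed
      have Klow: "C1 * real N powr \<delta> * (real Q ^ (\<kappa> - 1) + real Q ^ (\<kappa> + k) / real N) \<le> K ^ \<kappa>"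
      proof -
        define u where "u = real Q powr ((real \<kappa> - 1) / real \<kappa>)"
        define v where "v = real Q powr ((real \<kappa> + real k) / real \<kappa>) * real N powr - (1 / real \<kappa>)"
        have uv: "u \<ge> 0" "v \<ge> 0"
          by (simp_all add: u_def v_def)
        have "u ^ \<kappa> = real Q powr real (\<kappa> - 1)"
          using \<kappa>0 Q1 by (simp add: u_def powr_power of_nat_diff)
        then have u: "u ^ \<kappa> = real Q ^ (\<kappa> - 1)"
          using Q1 by (simp add: powr_realpow)
        have "v ^ \<kappa> = real Q powr real (\<kappa> + k) * real N powr -1"
          using \<kappa>0 Q1 N0 by (simp add: v_def powr_power power_mult_distrib)
        then have v: "v ^ \<kappa> = real Q ^ (\<kappa> + k) / real N"
          using Q1 N0 by (simp add: powr_realpow powr_minus field_simps del: of_nat_add)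
        \<comment> \<open>Superadditivity of the power on nonnegative reals allows the root to be
          taken term by term.\<close>
        have "u ^ \<kappa> + v ^ \<kappa> \<le> (u + v) ^ \<kappa>"
        proof -
          obtain l where l: "\<kappa> = Suc l"
            using \<kappa>0 by (cases \<kappa>) auto
          have "u ^ Suc l + v ^ Suc l = u * u ^ l + v * v ^ l"
            by simp
          also have "\<dots> \<le> u * (u + v) ^ l + v * (u + v) ^ l"
            using uv by (intro add_mono mult_left_mono power_mono) auto
          finally show ?thesis
            by (simp add: l distrib_right)
        qed
        moreover have "B ^ \<kappa> = C1"
          using C1 \<kappa>0 by (simp add: B_def powr_power)
        moreover have "(real N powr \<eta>) ^ \<kappa> = real N powr \<delta>"
          using N0 by (simp add: powr_power \<eta>_def \<delta>_def)
        ultimately have "C1 * real N powr \<delta> * (u ^ \<kappa> + v ^ \<kappa>) \<le> B ^ \<kappa> * (real N powr \<eta>) ^ \<kappa> * (u + v) ^ \<kappa>"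
          using C1 by (simp add: mult_left_mono)
        then show ?thesis
          unfolding K_def VN u_def[symmetric] v_def[symmetric] by (simp add: u v power_mult_distrib)
      qed
      define X where "X = Sigma {1..Q} (coprime_residues k)"
      have "T = (\<Sum>r\<in>X. S (fst r) (snd r))"
        unfolding T_def X_def by (subst sum.Sigma) (auto simp: coprime_residues_def case_prod_unfold)
      also have "\<dots> \<le> 4 * K * real N * harm (N + 1) * E"
        unfolding S_def E_def
      proof (rule large_sieve_clusters)
        show "finite X"
          by (auto simp: X_def coprime_residues_def)
        fix Y assume Y: "Y \<subseteq> X"
          and near: "\<And>s s'. s \<in> Y \<Longrightarrow> s' \<in> Y \<Longrightarrow>
            \<exists>z::int. \<bar>real (snd s) / real (fst s) ^ k - real (snd s') / real (fst s') ^ k - z\<bar> < 1 / real N"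
        have "real (card Y) ^ \<kappa> \<le> C1 * real N powr \<delta> * (real Q ^ (\<kappa> - 1) + real Q ^ (\<kappa> + k) / real N)"
        proof (rule close)
          show "Q ^ k \<le> N"
            using False by simp
          show "Y \<subseteq> Sigma {1..Q} (coprime_residues k)"
            using Y by (simp add: X_def)
          show "\<exists>z::int. \<bar>real b / real q ^ k - real b' / real q' ^ k - z\<bar> < 1 / real N"
            if "(q, b) \<in> Y" "(q', b') \<in> Y" for q b q' b'
            using near[OF that] by simp
        qed
        also note Klow
        finally show "real (card Y) \<le> K"
          using K0 \<kappa>0 by (simp add: power_mono_iff)
      qed (use N1 K0 in auto)
      also have "\<dots> \<le> 4 * K * real N * (H * real N powr \<eta>) * E"
        using harm_le_powr[OF \<eta> N1] K0 by (intro mult_right_mono mult_left_mono E0) (auto simp: H_def)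
      also have "\<dots> = (4 * B * H) * (real N powr \<epsilon> * V) * E"
      proof -
        have "real N powr \<epsilon> = real N powr \<eta> * real N powr \<eta>"
          by (simp add: \<eta>_def flip: powr_add)
        then show ?thesis
          using N0 by (simp add: K_def)
      qed
      also have "\<dots> \<le> C0 * (real Q ^ (k + 1) + real N powr \<epsilon> * V) * E"
        using BH V0 by (intro mult_right_mono mult_mono E0) (auto simp: C0_def)
      finally show ?thesis .
    qed
    \<comment> \<open>Since \<open>Q \<ge> 1\<close>, the factor \<open>ln 2\<close> can be raised
      to \<open>ln (2 * Q)\<close>.\<close>
    also have "\<dots> = C0 / ln 2 * ln 2 * (real Q ^ (k + 1) + real N powr \<epsilon> * V) * E"
      by simp
    also have "\<dots> \<le> C0 / ln 2 * ln (2 * real Q) * (real Q ^ (k + 1) + real N powr \<epsilon> * V) * E"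
      using BH V0 Q1 by (intro mult_right_mono mult_left_mono E0) (auto simp: C0_def)
    finally show ?thesis
      by (simp only: T_def S_def V_def E_def unit_exp_fraction)
  qed
  have "C0 / ln 2 > 0"
    using BH by (simp add: C0_def)
  then show ?thesis
    using bound by blast
qed

end
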